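(* Let $G$ be a connected graph of order $n\geq 11$ that is $1$-binding (i.e. $bind(G)\geq 1$). If $$\rho(G)\geq\rho(K_1\vee(K_{n-4}\cup K_2\cup K_1)),$$ then $G$ has an $H$-factor for each set-valued function $H:V(G)\longrightarrow\{\{1\},\{0,2\}\}$ with $|H^{-1}(1)|$ even, unless $G=K_1\vee(K_{n-4}\cup K_2\cup K_1)$ (up to isomorphism).
   Context: All graphs are finite, undirected, without loops or multiple edges. $K_m$ is the complete graph of order $m$. $G_1\cup G_2$ denotes the disjoint union of vertex-disjoint graphs, and $G_1\vee G_2$ denotes the join, obtained from $G_1\cup G_2$ by joining each vertex of $G_1$ to each vertex of $G_2$ by an edge. For $S\subseteq V(G)$, $N_G(S)$ denotes the set of neighbors of $S$ in $G$, that is, $N_G(S)=\bigcup_{v\in S}N_G(v)$. The binding number of $G$ is $$bind(G)=\min\left\{\frac{|N_G(S)|}{|S|}:\emptyset\neq S\subseteq V(G),\ N_G(S)\neq V(G)\right\}.$$ For a positive real number $r$, $G$ is $r$-binding if $bind(G)\geq r$. $\rho(G)$ denotes the adjacency spectral radius of $G$, i.e. the largest eigenvalue of its adjacency matrix $A(G)$. For a function $H:V(G)\longrightarrow\{\{1\},\{0,2\}\}$ (so each $H(v)$ equals $\{1\}$ or $\{0,2\}$), let $H^{-1}(1)=\{v\in V(G): H(v)=\{1\}\}$. An $H$-factor of $G$ is a spanning subgraph $F$ of $G$ such that $d_F(v)\in H(v)$ for each $v\in V(G)$, where $d_F(v)$ is the degree of $v$ in $F$. *)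

theory Defs
  imports "Graph_Theory.Graph_Theory" "Jordan_Normal_Form.Spectral_Radius"
begin

text \<open>
  Finite simple graphs are the \<^locale>\<open>pair_graph\<close>s of the Graph_Theory library: an undirected
  edge \<open>uv\<close> is represented by the two arcs \<open>(u, v)\<close> and \<open>(v, u)\<close>. Accordingly the degree of a vertex
  is its \<^const>\<open>out_degree\<close>.
\<close>

definition complete_graph :: "nat \<Rightarrow> nat pair_pre_digraph" where
  "complete_graph m = \<lparr> pverts = {..<m}, parcs = {(u, v). u < m \<and> v < m \<and> u \<noteq> v} \<rparr>"

definition disjoint_union ::
    "'a pair_pre_digraph \<Rightarrow> 'b pair_pre_digraph \<Rightarrow> ('a + 'b) pair_pre_digraph" where
  "disjoint_union G1 G2 =
    \<lparr> pverts = pverts G1 <+> pverts G2,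
      parcs = map_prod Inl Inl ` parcs G1 \<union> map_prod Inr Inr ` parcs G2 \<rparr>"

definition graph_join ::
    "'a pair_pre_digraph \<Rightarrow> 'b pair_pre_digraph \<Rightarrow> ('a + 'b) pair_pre_digraph" where
  "graph_join G1 G2 =
    \<lparr> pverts = pverts (disjoint_union G1 G2),
      parcs = parcs (disjoint_union G1 G2)
        \<union> Inl ` pverts G1 \<times> Inr ` pverts G2 \<union> Inr ` pverts G2 \<times> Inl ` pverts G1 \<rparr>"

lemma complete_digraph_complete_graph:
  "complete_digraph m (with_proj (complete_graph m))"
  by (auto simp: complete_digraph_pair_def complete_graph_def)

lemma pair_graph_iff:
  "pair_graph G \<longleftrightarrow>
    finite (pverts G) \<and> parcs G \<subseteq> pverts G \<times> pverts G \<and> sym (parcs G) \<and> irrefl (parcs G)"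
proof
  assume "pair_graph G"
  then interpret pair_graph G .
  show "finite (pverts G) \<and> parcs G \<subseteq> pverts G \<times> pverts G \<and> sym (parcs G) \<and> irrefl (parcs G)"
    using pair_finite_verts arc_fst_in_verts arc_snd_in_verts pair_sym_arcs pair_no_loops
    by (fastforce simp: symmetric_def irrefl_def)
next
  assume *: "finite (pverts G) \<and> parcs G \<subseteq> pverts G \<times> pverts G \<and> sym (parcs G) \<and> irrefl (parcs G)"
  then have "finite (parcs G)"
    by (meson finite_SigmaI finite_subset)
  with * show "pair_graph G"
    by unfold_locales (auto simp: symmetric_def irrefl_def)
qed

lemma pair_graph_disjoint_union:
  assumes "pair_graph G1" and "pair_graph G2"
  shows "pair_graph (disjoint_union G1 G2)"
  using assms unfolding pair_graph_iff disjoint_union_def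
  by (auto simp: sym_def irrefl_def intro: rev_image_eqI)

lemma pair_graph_graph_join:
  assumes "pair_graph G1" and "pair_graph G2"
  shows "pair_graph (graph_join G1 G2)"
proof -
  let ?U = "disjoint_union G1 G2"
  let ?J = "Inl ` pverts G1 \<times> Inr ` pverts G2 \<union> Inr ` pverts G2 \<times> Inl ` pverts G1"
  have U: "finite (pverts ?U)" "parcs ?U \<subseteq> pverts ?U \<times> pverts ?U" "sym (parcs ?U)" "irrefl (parcs ?U)"
    using pair_graph_disjoint_union[OF assms] by (auto simp: pair_graph_iff)
  have "?J \<subseteq> pverts ?U \<times> pverts ?U" "sym ?J" "irrefl ?J"
    by (auto simp: disjoint_union_def sym_def irrefl_def)
  with U have "parcs ?U \<union> ?J \<subseteq> pverts ?U \<times> pverts ?U" "sym (parcs ?U \<union> ?J)" "irrefl (parcs ?U \<union> ?J)"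
    by (meson Un_least, meson sym_Un, meson UnE irrefl_def)
  with U(1) show ?thesis
    by (simp add: pair_graph_iff graph_join_def Un_assoc)
qed

definition neighbors :: "'a pair_pre_digraph \<Rightarrow> 'a set \<Rightarrow> 'a set" where
  "neighbors G S = (\<Union>v\<in>S. {w. (v, w) \<in> parcs G})"

definition binding_number :: "'a pair_pre_digraph \<Rightarrow> real" where
  "binding_number G = Min {real (card (neighbors G S)) / real (card S) |S.
      S \<noteq> {} \<and> S \<subseteq> pverts G \<and> neighbors G S \<noteq> pverts G}"

definition r_binding :: "real \<Rightarrow> 'a pair_pre_digraph \<Rightarrow> bool" where
  "r_binding r G \<longleftrightarrow> r > 0 \<and> binding_number G \<ge> r"

text \<open>
  Matrices are indexed by \<open>0, \<dots>, n - 1\<close>, so the adjacency matrix depends on an ordering of the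
  vertices; all orderings give similar matrices, hence the same spectrum, and we fix an arbitrary one.
\<close>

definition vertex_list :: "'a pair_pre_digraph \<Rightarrow> 'a list" where
  "vertex_list G = (SOME vs. distinct vs \<and> set vs = pverts G)"

lemma vertex_list:
  assumes "finite (pverts G)"
  shows "distinct (vertex_list G)" and "set (vertex_list G) = pverts G"
proof -
  have "\<exists>vs. distinct vs \<and> set vs = pverts G"
    using finite_distinct_list[OF assms] by blast
  then have "distinct (vertex_list G) \<and> set (vertex_list G) = pverts G"
    unfolding vertex_list_def by (rule someI_ex)
  then show "distinct (vertex_list G)" and "set (vertex_list G) = pverts G"
    by auto
qed

definition adjacency_matrix :: "'a pair_pre_digraph \<Rightarrow> real mat" where
  "adjacency_matrix G =
    (let vs = vertex_list G in
      mat (length vs) (length vs) (\<lambda>(i, j). if (vs ! i, vs ! j) \<in> parcs G then 1 else 0))"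

text \<open>
  The adjacency matrix is real symmetric, so its real spectrum is finite and
  nonempty whenever the graph has a vertex.
\<close>

definition rho :: "'a pair_pre_digraph \<Rightarrow> real" where
  "rho G = Max (spectrum (adjacency_matrix G))"

definition H_factor :: "('a \<Rightarrow> nat set) \<Rightarrow> 'a pair_pre_digraph \<Rightarrow> 'a pair_pre_digraph \<Rightarrow> bool" where
  "H_factor H G F \<longleftrightarrow>
    pair_graph F \<and> spanning (with_proj F) (with_proj G) \<and>
    (\<forall>v\<in>pverts G. out_degree (with_proj F) v \<in> H v)"

definition extremal_graph :: "nat \<Rightarrow> (nat + (nat + nat) + nat) pair_pre_digraph" where
  "extremal_graph n =
    graph_join (complete_graph 1)
      (disjoint_union (disjoint_union (complete_graph (n - 4)) (complete_graph 2)) (complete_graph 1))"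

end

theory Submission
  imports Defs
begin

text \<open>
  Doubling the vertices \<open>v\<close> with \<open>H v = {0, 2}\<close> into two adjacent copies turns an \<open>H\<close>-factor into a perfect
  matching. If there is none, then Tutte's theorem, parity and connectedness yield a nonempty set \<open>S\<close>
  such that \<open>G - S\<close> splits into at least \<open>\<bar>S\<bar> + 2\<close> classes without edges between them, and 1-binding
  allows at most \<open>\<bar>S\<bar>\<close> of these to be singletons. So \<open>G\<close> is a spanning subgraph of a join of a complete
  graph on \<open>S\<close> with a disjoint union of complete graphs. An explicit positive vector \<open>y\<close> with
  \<open>A y \<le> (n - 4) y\<close> shows \<open>\<rho>(G) \<le> n - 4\<close>, which is less than the spectral radius of the extremal
  graph, except when \<open>\<bar>S\<bar> = 1\<close> and the classes have sizes \<open>n - 4\<close>, \<open>2\<close>, \<open>1\<close>; then \<open>G\<close> is a spanning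
  subgraph of the extremal graph, and connectedness makes its spectral radius strictly smaller unless
  the two coincide.
\<close>

subsection \<open>Tutte's theorem\<close>

text \<open>A matching is encoded as an involution along the arcs of \<open>E\<close>. The
  definition itself allows fixed points; irreflexivity of \<open>E\<close> excludes them where this
  matters.\<close>

definition perfect_matching :: "'a set \<Rightarrow> ('a \<times> 'a) set \<Rightarrow> ('a \<Rightarrow> 'a) \<Rightarrow> bool" where
  "perfect_matching V E f \<longleftrightarrow> (\<forall>v\<in>V. f v \<in> V \<and> f (f v) = v \<and> (v, f v) \<in> E)"

lemma perfect_matching_clique:
  assumes "finite V" "even (card V)" "\<And>v w. v \<in> V \<Longrightarrow> w \<in> V \<Longrightarrow> v \<noteq> w \<Longrightarrow> (v, w) \<in> E"
  shows "\<exists>f. perfect_matching V E f"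
  using assms
proof (induction "card V" arbitrary: V rule: less_induct)
  case less
  show ?case
  proof (cases "V = {}")
    case True
    then show ?thesis by (auto simp: perfect_matching_def)
  next
    case False
    then obtain a where a: "a \<in> V" by blast
    have "V \<noteq> {a}" using less.prems(2) by auto
    then obtain b where b: "b \<in> V" "b \<noteq> a" using a by blast
    let ?W = "V - {a, b}"
    have ab: "card V = card ?W + 2"
      using a b less.prems(1) card_Diff_subset[of "{a, b}" V] card_mono[of V "{a, b}"] by simp
    then have "card ?W < card V" "even (card ?W)" using less.prems(2) by auto
    then obtain f where f: "perfect_matching ?W E f"
      using less.hyps[of ?W] less.prems by (metis (no_types, lifting) Diff_iff finite_Diff)
    have "perfect_matching V E (f(a := b, b := a))"
      using f a b less.prems(3) unfolding perfect_matching_def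
      by (auto split: if_splits)
    then show ?thesis by blast
  qed
qed

lemma perfect_matching_Union:
  assumes "disjoint \<A>" "\<And>A. A \<in> \<A> \<Longrightarrow> \<exists>f. perfect_matching A E f"
  shows "\<exists>f. perfect_matching (\<Union>\<A>) E f"
proof -
  obtain F where F: "\<And>A. A \<in> \<A> \<Longrightarrow> perfect_matching A E (F A)"
    using assms(2) by metis
  define f where "f v = F (THE A. A \<in> \<A> \<and> v \<in> A) v" for v
  have f: "f v = F A v" if "A \<in> \<A>" "v \<in> A" for A v
  proof -
    have "(THE A. A \<in> \<A> \<and> v \<in> A) = A"
      using that assms(1) by (intro the_equality) (auto simp: disjoint_def)
    then show ?thesis by (simp add: f_def)
  qed
  have "perfect_matching (\<Union>\<A>) E f"
    unfolding perfect_matching_def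
  proof
    fix v assume "v \<in> \<Union>\<A>"
    then obtain A where A: "A \<in> \<A>" "v \<in> A" by blast
    then have "F A v \<in> A" "F A (F A v) = v" "(v, F A v) \<in> E"
      using F[OF A(1)] by (auto simp: perfect_matching_def)
    then show "f v \<in> \<Union>\<A> \<and> f (f v) = v \<and> (v, f v) \<in> E"
      using A f by auto
  qed
  then show ?thesis by blast
qed

text \<open>
  The composition \<open>g \<circ> f\<close> walks along an alternating cycle two edges at a time, starting with an
  edge of \<open>f\<close>; the \<open>g\<close>-partner of the start is at odd distance.
\<close>

lemma alternating_walk_ne:
  assumes f: "\<And>v. v \<in> V \<Longrightarrow> f v \<in> V \<and> f (f v) = v \<and> f v \<noteq> v"
    and g: "\<And>v. v \<in> V \<Longrightarrow> g v \<in> V \<and> g (g v) = v \<and> g v \<noteq> v"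
    and "x \<in> V"
  shows "((\<lambda>v. g (f v)) ^^ j) x \<noteq> g x"
  using \<open>x \<in> V\<close>
proof (induction j arbitrary: x rule: less_induct)
  case (less j)
  let ?T = "\<lambda>v. g (f v)"
  consider "j = 0" | "j = 1" | i where "j = Suc (Suc i)"
    by (metis One_nat_def not0_implies_Suc)
  then show ?case
  proof cases
    case 1
    then show ?thesis using g less.prems by force
  next
    case 2
    then show ?thesis using f g less.prems by (metis (no_types, lifting) One_nat_def funpow_0 funpow_simps_right(2) o_apply)
  next
    case 3
    show ?thesis
    proof
      assume *: "(?T ^^ j) x = g x"
      have V: "(?T ^^ k) v \<in> V" if "v \<in> V" for k v
        using that by (induction k) (use f g in auto)
      \<comment> \<open>Cancelling \<open>g\<close> and \<open>f\<close> moves the equation from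
        \<open>x\<close> and \<open>j\<close> to \<open>?T x\<close> and
        \<open>j - 2\<close>.\<close>
      have "?T ((?T ^^ i) (?T x)) = g x"
        using * 3 by (metis (no_types, lifting) funpow.simps(2) funpow_swap1 o_apply)
      moreover have "(?T ^^ i) (?T x) \<in> V" using V f g less.prems by blast
      ultimately have "(?T ^^ i) (?T x) = g (?T x)"
        using f g less.prems by metis
      then show False using less.IH[of i "?T x"] 3 f g less.prems by auto
    qed
  qed
qed

text \<open>The exchange step of Lovasz's proof of Tutte's theorem. Follow the alternating cycle of
  \<open>f\<close> and \<open>g\<close> through the edge \<open>bd\<close>, leaving \<open>d\<close>
  by \<open>f\<close>. If it returns to \<open>b\<close> without meeting \<open>ac\<close>, then
  \<open>f\<close> on the cycle and \<open>g\<close> elsewhere use neither new edge. Otherwise let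
  \<open>e\<close> be the first end of \<open>ac\<close> that it meets: use \<open>f\<close> before
  \<open>e\<close>, then the edge \<open>eb\<close> of \<open>E\<close>, and \<open>g\<close>
  elsewhere.\<close>

lemma perfect_matching_exchange:
  assumes V: "finite V" and E: "irrefl E" "sym E"
    and f: "perfect_matching V (insert (a, c) (insert (c, a) E)) f" and fa: "f a = c" and ac: "a \<noteq> c"
    and g: "perfect_matching V (insert (b, d) (insert (d, b) E)) g" and gb: "g b = d" and bd: "b \<noteq> d"
    and in_V: "a \<in> V" "b \<in> V" "c \<in> V" "d \<in> V"
    and edges: "(a, b) \<in> E" "(c, b) \<in> E"
  shows "\<exists>h. perfect_matching V E h"
proof -
  have f': "f v \<in> V \<and> f (f v) = v \<and> f v \<noteq> v" if "v \<in> V" for v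
    using f that E(1) ac unfolding perfect_matching_def irrefl_def by fastforce
  have g': "g v \<in> V \<and> g (g v) = v \<and> g v \<noteq> v" if "v \<in> V" for v
    using g that E(1) bd unfolding perfect_matching_def irrefl_def by fastforce
  have fc: "f c = a" and gd: "g d = b" using f' g' in_V fa gb by auto
  have fE: "(v, f v) \<in> E" if "v \<in> V" "v \<noteq> a" "v \<noteq> c" for v
    using f that unfolding perfect_matching_def by auto
  have gE: "(v, g v) \<in> E" if "v \<in> V" "v \<noteq> b" "v \<noteq> d" for v
    using g that unfolding perfect_matching_def by auto
  \<comment> \<open>\<open>x\<close> lists every second vertex of the walk from \<open>d\<close>;
    the vertices in between are the \<open>f (x j)\<close>.\<close>
  define x where "x j = ((\<lambda>v. g (f v)) ^^ j) d" for j
  have x0: "x 0 = d" and xS: "x (Suc j) = g (f (x j))" for j by (simp_all add: x_def)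
  have xV: "x j \<in> V" for j by (induction j) (use x0 xS f' g' in_V in auto)
  \<comment> \<open>\<open>b\<close> is the \<open>g\<close>-partner of the start, so the walk can
    meet it only as some \<open>f (x j)\<close>.\<close>
  have xb: "x j \<noteq> b" for j
    using alternating_walk_ne[of V f g d j] f' g' in_V gd by (auto simp: x_def)
  \<comment> \<open>\<open>g \<circ> f\<close> is injective on \<open>V\<close>, so a repetition can
    be traced back to the start.\<close>
  have inj: "x i = x j \<Longrightarrow> i \<le> j \<Longrightarrow> x (j - i) = d" for i j
  proof (induction i arbitrary: j)
    case (Suc i)
    then obtain j' where j': "j = Suc j'" by (cases j) auto
    then have "x i = x j'" using Suc.prems(1) f' g' xV xS by metis
    then show ?case using Suc j' by auto
  qed (simp add: x0)
  have "\<not> inj_on x UNIV"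
    using V xV finite_subset[of "range x" V] finite_imageD[of x UNIV] infinite_UNIV_nat
    by (metis image_subsetI)
  then obtain i j where "i < j" "x i = x j"
    by (metis inj_onI linorder_neqE_nat)
  then have "x (Suc (j - i - 1)) = d" using inj[of i j] by (simp add: Suc_diff_Suc)
  then have "f (x (j - i - 1)) = b" using xS[of "j - i - 1"] xV f' g' gd by metis
  then have ex: "\<exists>k. f (x k) = b \<or> x k \<in> {a, c}" by blast
  \<comment> \<open>The first time that the walk meets \<open>b\<close> or the edge
    \<open>ac\<close>. As \<open>f\<close> swaps \<open>a\<close> and \<open>c\<close>, testing
    \<open>x k\<close> also covers \<open>f (x k)\<close>.\<close>
  define k where "k = (LEAST k. f (x k) = b \<or> x k \<in> {a, c})"
  have k: "f (x k) = b \<or> x k \<in> {a, c}" using LeastI_ex[OF ex] by (simp add: k_def)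
  have less: "f (x j) \<noteq> b" "x j \<notin> {a, c}" if "j < k" for j
    using not_less_Least[of j "\<lambda>k. f (x k) = b \<or> x k \<in> {a, c}"] that by (auto simp: k_def)
  have gx: "g (x j) = f (x (j - 1))" if "j > 0" for j
    using that xS[of "j - 1"] g' f' xV by auto
  show ?thesis
  proof (cases "x k \<in> {a, c}")
    case False
    then have kb: "f (x k) = b" using k by blast
    \<comment> \<open>Here the walk closes up through \<open>b\<close>: \<open>C\<close> is a whole
      alternating cycle, stable under \<open>f\<close> and \<open>g\<close>, containing
      \<open>b\<close> and \<open>d\<close> but neither \<open>a\<close> nor
      \<open>c\<close>.\<close>
    define C where "C = x ` {..k} \<union> (\<lambda>j. f (x j)) ` {..k}"
    have nac: "x j \<notin> {a, c}" if "j \<le> k" for j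
      using that less[of j] False by (cases "j = k") auto
    have C_ac: "a \<notin> C" "c \<notin> C"
      using nac fa fc f' xV unfolding C_def by (auto) (metis atMost_iff)+
    have C_bd: "b \<in> C" "d \<in> C" using kb x0 by (auto simp: C_def)
    have CV: "C \<subseteq> V" using xV f' by (auto simp: C_def)
    have Cf: "f v \<in> C" if "v \<in> C" for v
      using that xV f' by (auto simp: C_def)
    have Cg: "g v \<in> C" if "v \<in> C" for v
    proof -
      from that consider j where "j \<le> k" "v = x j" | j where "j \<le> k" "v = f (x j)"
        by (auto simp: C_def)
      then show ?thesis
      proof cases
        case 1
        then show ?thesis
          using gx[of j] C_bd x0 gd by (cases "j = 0") (auto simp: C_def)
      next
        case 2
        show ?thesis
        proof (cases "j = k")
          case True
          then show ?thesis using 2 C_bd kb gb by simp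
        next
          case False
          then have "x (Suc j) \<in> x ` {..k}" using 2 by (intro imageI) simp
          then show ?thesis using 2 xS[of j] by (simp add: C_def)
        qed
      qed
    qed
    have "perfect_matching V E (\<lambda>v. if v \<in> C then f v else g v)"
      unfolding perfect_matching_def
    proof
      fix v assume v: "v \<in> V"
      show "(if v \<in> C then f v else g v) \<in> V \<and>
         (if (if v \<in> C then f v else g v) \<in> C then f (if v \<in> C then f v else g v)
          else g (if v \<in> C then f v else g v)) = v \<and>
         (v, if v \<in> C then f v else g v) \<in> E"
      proof (cases "v \<in> C")
        case True
        then show ?thesis using v f' Cf fE C_ac by auto
      next
        case False
        then have "g v \<notin> C" using Cg g' v by metis
        then show ?thesis using False v g' gE C_bd by auto
      qed
    qed
    then show ?thesis by blast
  next
    case True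
    define e where "e = x k"
    have e: "e \<in> V" "(e, b) \<in> E" "(b, e) \<in> E" "e \<noteq> b" "e = a \<or> e = c"
      using True in_V edges E xb symD[OF E(2)] by (auto simp: e_def)
    \<comment> \<open>\<open>D\<close> is the part of the walk strictly before \<open>e\<close>,
      which \<open>f\<close> matches within itself. Adding \<open>b\<close> and \<open>e\<close>
      makes it stable under \<open>g\<close>, so \<open>g\<close> can be used outside.\<close>
    define D where "D = x ` {..<k} \<union> (\<lambda>j. f (x j)) ` {..<k}"
    have DV: "D \<subseteq> V" using xV f' by (auto simp: D_def)
    have De: "a \<notin> D" "c \<notin> D"
      using less fa fc f' xV unfolding D_def by (auto) (metis lessThan_iff)+
    have Db: "b \<notin> D" using xb less by (auto simp: D_def)
    have Df: "f v \<in> D" if "v \<in> D" for v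
      using that xV f' by (auto simp: D_def)
    let ?C = "D \<union> {b, e}"
    have d: "d \<in> ?C" using x0 by (cases "k = 0") (auto simp: D_def e_def)
    have Cg: "g v \<in> ?C" if "v \<in> ?C" for v
    proof -
      from that have "(\<exists>j\<le>k. v = x j) \<or> (\<exists>j<k. v = f (x j)) \<or> v = b"
        by (auto simp: D_def e_def intro: less_imp_le)
      then consider j where "j \<le> k" "v = x j" | j where "j < k" "v = f (x j)" | "v = b"
        by blast
      then show ?thesis
      proof cases
        case 1
        then show ?thesis
          using gx[of j] x0 gd by (cases "j = 0") (auto simp: D_def)
      next
        case 2
        then have "x (Suc j) \<in> insert e (x ` {..<k})"
          by (cases "Suc j = k") (auto simp: e_def)
        then show ?thesis using 2 xS[of j] by (auto simp: D_def)
      next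
        case 3
        then show ?thesis using gb d by auto
      qed
    qed
    define h where "h v = (if v = b then e else if v = e then b else if v \<in> D then f v else g v)" for v
    have "perfect_matching V E h"
      unfolding perfect_matching_def
    proof
      fix v assume v: "v \<in> V"
      consider "v = b" | "v = e" | "v \<in> D" "v \<noteq> b" "v \<noteq> e" | "v \<notin> ?C" by blast
      then show "h v \<in> V \<and> h (h v) = v \<and> (v, h v) \<in> E"
      proof cases
        case 1
        then show ?thesis using e in_V by (auto simp: h_def)
      next
        case 2
        then show ?thesis using e in_V by (auto simp: h_def)
      next
        case 3
        then have "h v = f v" "f v \<in> D" by (auto simp: h_def Df)
        moreover from this have "f v \<noteq> b" "f v \<noteq> e" using Db De e by auto
        moreover have "v \<noteq> a" "v \<noteq> c" using De 3 by auto
        ultimately show ?thesis using f' v fE by (auto simp: h_def)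
      next
        case 4
        then have "g v \<notin> ?C" using Cg g' v by metis
        moreover have "h v = g v" using 4 by (auto simp: h_def)
        ultimately show ?thesis using g' v gE 4 d by (auto simp: h_def)
      qed
    qed
    then show ?thesis by blast
  qed
qed

text \<open>Tutte's theorem. In an edge-maximal graph \<open>M\<close> without perfect matching, let
  \<open>S\<close> consist of the vertices adjacent to all others. Off \<open>S\<close> the graph is
  a disjoint union of cliques, since otherwise the exchange applies; with at most
  \<open>card S\<close> odd cliques a perfect matching could be built. Classes are fibres of a
  labelling, so one class may merge several components of \<open>E\<close> off
  \<open>S\<close>.\<close>

lemma tutte_barrier:
  fixes V :: "'a set"
  assumes V: "finite V" "even (card V)" and E: "E \<subseteq> V \<times> V" "irrefl E" "sym E"
    and no_pm: "\<nexists>f. perfect_matching V E f"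
  shows "\<exists>S (\<kappa> :: 'a \<Rightarrow> 'a set). S \<subseteq> V \<and> (\<forall>v\<in>V - S. \<forall>w\<in>V - S. (v, w) \<in> E \<longrightarrow> \<kappa> v = \<kappa> w) \<and>
    card S < card {Q \<in> \<kappa> ` (V - S). odd (card {v \<in> V - S. \<kappa> v = Q})}"
proof -
  define \<E> where "\<E> = {E' \<in> Pow (V \<times> V). irrefl E' \<and> sym E' \<and> (\<nexists>f. perfect_matching V E' f)}"
  have "finite \<E>" using V by (auto simp: \<E>_def)
  moreover have "E \<in> \<E>" using E no_pm by (auto simp: \<E>_def)
  ultimately obtain M where M: "M \<in> \<E>" "E \<subseteq> M" and max: "\<And>E'. E' \<in> \<E> \<Longrightarrow> M \<subseteq> E' \<Longrightarrow> M = E'"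
    using finite_has_maximal2[of \<E> E] by metis
  have MV: "M \<subseteq> V \<times> V" and irr: "irrefl M" and sym: "sym M" and Mno: "\<nexists>f. perfect_matching V M f"
    using M by (auto simp: \<E>_def)
  have add: "\<exists>f. perfect_matching V (insert (u, w) (insert (w, u) M)) f"
    if "u \<in> V" "w \<in> V" "u \<noteq> w" "(u, w) \<notin> M" for u w
  proof (rule ccontr)
    assume "\<not> ?thesis"
    then have "insert (u, w) (insert (w, u) M) \<in> \<E>"
      using that MV irr sym by (auto simp: \<E>_def irrefl_def sym_def)
    then show False using max that by blast
  qed
  define S where "S = {v \<in> V. \<forall>w\<in>V. w \<noteq> v \<longrightarrow> (v, w) \<in> M}"
  have SV: "S \<subseteq> V" by (auto simp: S_def)
  have trans: "(a, c) \<in> M" if abc: "a \<in> V - S" "b \<in> V - S" "c \<in> V - S" "(a, b) \<in> M" "(b, c) \<in> M" "a \<noteq> c" for a b c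
  proof (rule ccontr)
    assume nac: "(a, c) \<notin> M"
    \<comment> \<open>\<open>b\<close> lies outside \<open>S\<close>, hence misses some edge
      \<open>bd\<close>. Adding \<open>ac\<close> and adding \<open>bd\<close> yield the two
      matchings for the exchange.\<close>
    from that obtain d where d: "d \<in> V" "d \<noteq> b" "(b, d) \<notin> M" by (auto simp: S_def)
    obtain f where f: "perfect_matching V (insert (a, c) (insert (c, a) M)) f"
      using add[of a c] abc nac by blast
    obtain g where g: "perfect_matching V (insert (b, d) (insert (d, b) M)) g"
      using add[of b d] abc d by blast
    have used: "h u = w" if "perfect_matching V (insert (u, w) (insert (w, u) M)) h" "u \<in> V" "w \<in> V" for h u w
    proof (rule ccontr)
      assume "h u \<noteq> w"
      moreover from this have "h w \<noteq> u" using that by (auto simp: perfect_matching_def)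
      ultimately have "perfect_matching V M h"
        using that(1) by (auto simp: perfect_matching_def)
      then show False using Mno by blast
    qed
    have "f a = c" "g b = d" using used[OF f] used[OF g] abc d by blast+
    moreover have "(c, b) \<in> M" using abc symD[OF sym] by blast
    ultimately have "\<exists>h. perfect_matching V M h"
      using perfect_matching_exchange[OF V(1) irr sym f _ _ g] abc d by simp
    then show False using Mno by blast
  qed
  \<comment> \<open>Each clique of \<open>M\<close> off \<open>S\<close> serves as the label of its
    own vertices.\<close>
  define \<kappa> where "\<kappa> v = {w \<in> V - S. w = v \<or> (v, w) \<in> M}" for v
  have \<kappa>_eq: "\<kappa> v = \<kappa> w" if "v \<in> V - S" "w \<in> \<kappa> v" for v w
    using that trans symD[OF sym] unfolding \<kappa>_def by blast
  have self: "v \<in> \<kappa> v" if "v \<in> V - S" for v using that by (auto simp: \<kappa>_def)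
  define J where "J = \<kappa> ` (V - S)"
  have fib: "{v \<in> V - S. \<kappa> v = Q} = Q" if "Q \<in> J" for Q
    using that \<kappa>_eq self by (auto simp: J_def \<kappa>_def)
  have J: "finite J" "disjoint J" "\<Union>J = V - S" "\<And>Q. Q \<in> J \<Longrightarrow> finite Q"
  proof -
    show "finite J" using V by (simp add: J_def)
    show "disjoint J" unfolding disjoint_def using fib by blast
    show "\<Union>J = V - S" using self by (auto simp: J_def \<kappa>_def)
    show "finite Q" if "Q \<in> J" for Q using that V by (auto simp: J_def \<kappa>_def)
  qed
  define O' where "O' = {Q \<in> J. odd (card Q)}"
  have "card S < card O'"
  proof (rule ccontr)
    assume "\<not> ?thesis"
    then have le: "card O' \<le> card S" by simp
    have fS: "finite S" and fO: "finite O'"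
      using V SV J finite_subset by (auto simp: O'_def)
    obtain \<phi> where \<phi>: "\<phi> ` O' \<subseteq> S" "inj_on \<phi> O'"
      using card_le_inj[OF fO fS le] by blast
    define g where "g Q = (if odd (card Q) then insert (\<phi> Q) Q else Q)" for Q
    define R where "R = S - \<phi> ` O'"
    have JS: "Q \<inter> S = {}" if "Q \<in> J" for Q using that J(3) by auto
    have \<phi>S: "\<phi> Q \<in> S" if "Q \<in> J" "odd (card Q)" for Q using that \<phi> by (auto simp: O'_def)
    have gdis: "g P \<inter> g Q = {}" if "P \<in> J" "Q \<in> J" "P \<noteq> Q" for P Q
    proof -
      have "P \<inter> Q = {}" using J(2) that by (auto simp: disjoint_def)
      moreover have "\<phi> P \<noteq> \<phi> Q" if "odd (card P)" "odd (card Q)"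
        using that \<phi>(2) \<open>P \<in> J\<close> \<open>Q \<in> J\<close> \<open>P \<noteq> Q\<close> by (auto simp: O'_def inj_on_def)
      ultimately show ?thesis
        using JS[of P] JS[of Q] \<phi>S[of P] \<phi>S[of Q] that by (auto simp: g_def)
    qed
    have gR: "g P \<inter> R = {}" if "P \<in> J" for P
      using that JS[of P] by (auto simp: g_def R_def O'_def)
    have disj: "disjoint (insert R (g ` J))"
      unfolding disjoint_def using gdis gR by blast
    have Un: "\<Union>(insert R (g ` J)) = V"
    proof -
      have "g Q \<subseteq> V" if "Q \<in> J" for Q
        using that J(3) \<phi>S SV by (auto simp: g_def)
      moreover have "\<Union>J \<subseteq> \<Union>(g ` J)" by (auto simp: g_def)
      then have "V - S \<subseteq> \<Union>(g ` J)" using J(3) by simp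
      moreover have "\<phi> ` O' \<subseteq> \<Union>(g ` J)" by (auto simp: g_def O'_def)
      then have "S \<subseteq> R \<union> \<Union>(g ` J)" by (auto simp: R_def)
      moreover have "R \<subseteq> V" using SV by (auto simp: R_def)
      ultimately show ?thesis by auto
    qed
    have pm: "\<exists>f. perfect_matching A M f" if "A \<in> insert R (g ` J)" for A
    proof (rule perfect_matching_clique)
      have AV: "A \<subseteq> V" using that Un by blast
      then show "finite A" using V finite_subset by blast
      \<comment> \<open>\<open>card (V - S)\<close> has the parity of the number of odd cliques. As
        \<open>card V\<close> is even, \<open>card S - card O'\<close> is even too, so
        \<open>R\<close> can be paired up.\<close>
      have "card (V - S) = (\<Sum>Q\<in>J. card Q)"
        using card_Union_disjoint[of J] J by simp
      then have "even (card (V - S)) \<longleftrightarrow> even (card O')"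
        using even_sum_iff[OF J(1), of card] by (simp add: O'_def)
      moreover have "card V = card S + card (V - S)"
        using card_Diff_subset[OF fS SV] card_mono[OF V(1) SV] by simp
      moreover have "card R = card S - card O'"
        using card_Diff_subset[of "\<phi> ` O'" S] \<phi> fO by (simp add: R_def card_image)
      ultimately have "even (card R)" using V(2) le by auto
      moreover have "even (card (g Q))" if "Q \<in> J" for Q
        using that J(4)[of Q] disjoint_iff[THEN iffD1, OF JS[of Q]] \<phi>S[of Q] by (auto simp: g_def card_insert_if)
      ultimately show "even (card A)" using that by auto
      show "(v, w) \<in> M" if vw: "v \<in> A" "w \<in> A" "v \<noteq> w" for v w
      proof (cases "v \<in> S \<or> w \<in> S")
        case True
        then show ?thesis using vw AV symD[OF sym, of w v] by (auto simp: S_def)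
      next
        case False
        then have "A \<noteq> R" using vw by (auto simp: R_def)
        then obtain Q where Q: "Q \<in> J" "A = g Q" using \<open>A \<in> insert R (g ` J)\<close> by blast
        then have "v \<in> Q" "w \<in> Q"
          using False vw \<phi>S[of Q] by (auto simp: g_def split: if_splits)
        then have "w \<in> \<kappa> v" using fib[OF Q(1)] by auto
        then show ?thesis using vw by (auto simp: \<kappa>_def)
      qed
    qed
    show False
      using perfect_matching_Union[OF disj pm] Mno unfolding Un by blast
  qed
  moreover have "{Q \<in> \<kappa> ` (V - S). odd (card {v \<in> V - S. \<kappa> v = Q})} = O'"
    unfolding O'_def using fib by (auto simp: J_def)
  moreover have "\<kappa> v = \<kappa> w" if "v \<in> V - S" "w \<in> V - S" "(v, w) \<in> E" for v w
    using that M(2) by (intro \<kappa>_eq) (auto simp: \<kappa>_def)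
  ultimately show ?thesis using SV by (intro exI[of _ S] exI[of _ \<kappa>]) simp
qed

subsection \<open>Factors and barriers\<close>

lemma card_eq_sum_fibres:
  assumes "finite A"
  shows "card A = (\<Sum>y\<in>f ` A. card {x \<in> A. f x = y})"
  using sum.image_gen[OF assms, of "\<lambda>_. 1::nat" f] by simp

definition blow_up_verts :: "('a \<Rightarrow> nat set) \<Rightarrow> 'a set \<Rightarrow> ('a \<times> bool) set" where
  "blow_up_verts H V = {(v, b). v \<in> V \<and> (b \<longrightarrow> H v = {0, 2})}"

text \<open>Matching the two copies of a vertex to each other encodes degree 0; this is why they are
  adjacent.\<close>

definition blow_up_arcs :: "('a \<Rightarrow> nat set) \<Rightarrow> 'a pair_pre_digraph \<Rightarrow> (('a \<times> bool) \<times> ('a \<times> bool)) set" where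
  "blow_up_arcs H G = {(x, y). x \<in> blow_up_verts H (pverts G) \<and> y \<in> blow_up_verts H (pverts G) \<and>
    ((fst x, fst y) \<in> parcs G \<or> fst x = fst y \<and> snd x \<noteq> snd y)}"

lemma even_card_blow_up_verts:
  assumes "finite V" "\<forall>v\<in>V. H v \<in> {{1}, {0, 2}}" "even (card {v \<in> V. H v = {1}})"
  shows "even (card (blow_up_verts H V))"
proof -
  let ?B = "\<lambda>v. if H v = {1} then {False} else {False, True}"
  have "blow_up_verts H V = Sigma V ?B"
    using assms(2) by (auto simp: blow_up_verts_def split: if_splits)
  then have "card (blow_up_verts H V) = (\<Sum>v\<in>V. card (?B v))"
    using assms(1) by (simp add: card_SigmaI)
  moreover have "{v \<in> V. odd (card (?B v))} = {v \<in> V. H v = {1}}" by auto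
  ultimately show ?thesis
    using even_sum_iff[OF assms(1), of "\<lambda>v. card (?B v)"] assms(3) by simp
qed

text \<open>
  Two copies of \<open>v\<close> that are matched to the two copies of the same vertex contribute a double edge,
  which is dropped; so \<open>v\<close> keeps the edges to the vertices that receive exactly one of its copies.
\<close>

lemma H_factor_of_perfect_matching:
  assumes "pair_graph G" and H: "\<forall>v\<in>pverts G. H v \<in> {{1}, {0, 2}}"
    and f: "perfect_matching (blow_up_verts H (pverts G)) (blow_up_arcs H G) f"
  shows "\<exists>F. H_factor H G F"
proof -
  interpret pair_graph G by fact
  let ?W = "blow_up_verts H (pverts G)"
  have fW: "f x \<in> ?W" "f (f x) = x" "(fst x, fst (f x)) \<in> parcs G \<or> fst x = fst (f x) \<and> snd x \<noteq> snd (f x)"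
    if "x \<in> ?W" for x
    using f that unfolding perfect_matching_def blow_up_arcs_def by auto
  \<comment> \<open>The size of \<open>N v w\<close> is the multiplicity of the edge
    \<open>vw\<close> once the copies are merged again.\<close>
  define N where "N v w = {b. (v, b) \<in> ?W \<and> fst (f (v, b)) = w}" for v w
  \<comment> \<open>Following \<open>f\<close> embeds \<open>N v w\<close> into
    \<open>N w v\<close>. Used in both directions, this makes the multiplicity symmetric and
    \<open>F\<close> undirected.\<close>
  have le: "card (N v w) \<le> card (N w v)" for v w
  proof (rule card_inj_on_le)
    have inv: "(w, snd (f (v, b))) \<in> ?W \<and> f (w, snd (f (v, b))) = (v, b)" if "b \<in> N v w" for b
    proof -
      have b: "(v, b) \<in> ?W" "fst (f (v, b)) = w" using that by (simp_all add: N_def)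
      then have "f (v, b) = (w, snd (f (v, b)))" by (metis prod.collapse)
      then show ?thesis using fW(1,2)[OF b(1)] by metis
    qed
    show "inj_on (\<lambda>b. snd (f (v, b))) (N v w)"
    proof (rule inj_onI)
      fix b b' assume b: "b \<in> N v w" "b' \<in> N v w" and eq: "snd (f (v, b)) = snd (f (v, b'))"
      have "(v, b) = f (w, snd (f (v, b)))" using inv[OF b(1)] by (rule sym[OF conjunct2])
      also have "\<dots> = f (w, snd (f (v, b')))" by (simp only: eq)
      also have "\<dots> = (v, b')" using inv[OF b(2)] by (rule conjunct2)
      finally show "b = b'" by simp
    qed
    show "(\<lambda>b. snd (f (v, b))) ` N v w \<subseteq> N w v"
    proof
      fix b' assume "b' \<in> (\<lambda>b. snd (f (v, b))) ` N v w"
      then obtain b where "b \<in> N v w" "b' = snd (f (v, b))" by blast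
      then show "b' \<in> N w v" using inv[of b] by (simp add: N_def[of w v])
    qed
  qed simp
  define F where "F = \<lparr>pverts = pverts G, parcs = {(v, w). (v, w) \<in> parcs G \<and> card (N v w) = 1}\<rparr>"
  have F: "pair_graph F"
    unfolding pair_graph_iff
  proof (intro conjI)
    show "finite (pverts F)" using pair_finite_verts by (simp add: F_def)
    show "parcs F \<subseteq> pverts F \<times> pverts F" using in_arcsD1 in_arcsD2 by (auto simp: F_def)
    show "sym (parcs F)"
      using arcs_symmetric antisym[OF le le] by (auto simp: F_def sym_def)
    show "irrefl (parcs F)" using no_loops' by (auto simp: F_def irrefl_def)
  qed
  have "spanning (with_proj F) (with_proj G)"
  proof -
    have "wf_digraph (with_proj F)" "wf_digraph (with_proj G)"
      using F assms(1) by (simp_all add: wf_digraph_wp_iff pair_graph_def pair_digraph_def pair_fin_digraph_def)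
    then show ?thesis
      by (auto simp: spanning_def subgraph_def compatible_def F_def)
  qed
  moreover have "out_degree (with_proj F) v \<in> H v" if v: "v \<in> pverts G" for v
  proof -
    let ?D = "{w. (v, w) \<in> parcs G \<and> card (N v w) = 1}"
    have "out_arcs (with_proj F) v = Pair v ` ?D"
      by (auto simp: out_arcs_def F_def)
    then have deg: "out_degree (with_proj F) v = card ?D"
      by (simp add: out_degree_def card_image inj_on_def)
    have F0: "(v, False) \<in> ?W" using v by (simp add: blow_up_verts_def)
    let ?p = "fst (f (v, False))" and ?q = "fst (f (v, True))"
    have nl: "(v, v) \<notin> parcs G" using no_loops' by blast
    show ?thesis
    proof (cases "H v = {1}")
      case True
      then have T0: "(v, b) \<in> ?W \<longleftrightarrow> \<not> b" for b using v by (auto simp: blow_up_verts_def)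
      have "?p \<noteq> v"
      proof
        assume p: "?p = v"
        then have "(v, snd (f (v, False))) \<in> ?W" using fW(1)[OF F0] by (metis prod.collapse)
        then have "\<not> snd (f (v, False))" using T0 by blast
        then show False using fW(3)[OF F0] p nl by simp
      qed
      then have vp: "(v, ?p) \<in> parcs G" using fW(3)[OF F0] by auto
      have "b \<in> N v w \<longleftrightarrow> \<not> b \<and> w = ?p" for b w
        using T0[of b] by (cases b) (auto simp: N_def)
      then have N: "N v w = (if w = ?p then {False} else {})" for w by auto
      have "?D = {?p}" using vp by (auto simp: N)
      then show ?thesis using True deg by simp
    next
      case False
      then have Hv: "H v = {0, 2}" using H v by auto
      then have T0: "(v, b) \<in> ?W" for b using v by (auto simp: blow_up_verts_def)
      have "b \<in> N v w \<longleftrightarrow> (if b then w = ?q else w = ?p)" for b w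
        using T0[of b] by (cases b) (auto simp: N_def)
      then have N: "N v w = (if w = ?p then {False} else {}) \<union> (if w = ?q then {True} else {})" for w
        by (auto split: if_splits)
      show ?thesis
      proof (cases "?p = v \<or> ?q = v")
        case True
        \<comment> \<open>Since \<open>f\<close> is an involution, one copy being matched to the
          other implies the converse; then \<open>v\<close> gets degree 0.\<close>
        have "?p = v \<and> ?q = v"
        proof (cases "?p = v")
          case True
          then have "f (v, False) = (v, True)"
            using fW(3)[OF F0] nl by (auto simp: prod_eq_iff)
          then show ?thesis using fW(2)[OF F0] by simp
        next
          case False
          then have "?q = v" using True by simp
          then have "f (v, True) = (v, False)"
            using fW(3)[OF T0[of True]] nl by (auto simp: prod_eq_iff)
          then show ?thesis using fW(2)[OF T0[of True]] by simp
        qed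
        then have "?D = {}" using nl by (auto simp: N)
        then have "card ?D = 0" by (simp only: card.empty)
        then show ?thesis using deg Hv by simp
      next
        case False
        then have E: "(v, ?p) \<in> parcs G" "(v, ?q) \<in> parcs G"
          using fW(3)[OF T0[of False]] fW(3)[OF T0[of True]] by auto
        show ?thesis
        proof (cases "?p = ?q")
          case True
          then have "?D = {}" by (auto simp: N)
          then have "card ?D = 0" by (simp only: card.empty)
          then show ?thesis using deg Hv by simp
        next
          case False
          then have "?D = {?p, ?q}" using E by (auto simp: N split: if_splits)
          then have "card ?D = 2" using False by (simp only: card_2_iff) blast
          then show ?thesis using deg Hv by simp
        qed
      qed
    qed
  qed
  ultimately show ?thesis using F by (auto simp: H_factor_def)
qed

text \<open>A barrier \<open>T\<close> of the blow-up is projected to the set \<open>S\<close> of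
  vertices all of whose copies lie in \<open>T\<close>. Each of these has its copy
  \<open>(v, False)\<close> in \<open>T\<close>, so \<open>S\<close> is no larger than
  \<open>T\<close>. No class is lost, because two copies of one vertex outside \<open>T\<close> are
  adjacent and hence in the same class.\<close>

lemma barrier_of_no_H_factor:
  fixes G :: "'a pair_pre_digraph"
  assumes "pair_graph G" and H: "\<forall>v\<in>pverts G. H v \<in> {{1}, {0, 2}}"
    and even: "even (card {v \<in> pverts G. H v = {1}})" and no: "\<nexists>F. H_factor H G F"
  shows "\<exists>S (\<kappa> :: 'a \<Rightarrow> ('a \<times> bool) set). S \<subseteq> pverts G \<and>
    (\<forall>v\<in>pverts G - S. \<forall>w\<in>pverts G - S. (v, w) \<in> parcs G \<longrightarrow> \<kappa> v = \<kappa> w) \<and>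
    card S + 2 \<le> card (\<kappa> ` (pverts G - S))"
proof -
  interpret pair_graph G by fact
  let ?V = "pverts G"
  let ?W = "blow_up_verts H ?V" and ?A = "blow_up_arcs H G"
  have fW: "finite ?W"
    by (rule finite_subset[of _ "?V \<times> UNIV"]) (auto simp: blow_up_verts_def pair_finite_verts)
  have eW: "even (card ?W)" using even_card_blow_up_verts[OF pair_finite_verts H even] .
  have A: "?A \<subseteq> ?W \<times> ?W" "irrefl ?A" "sym ?A"
    using no_loops' arcs_symmetric by (auto simp: blow_up_arcs_def irrefl_def sym_def)
  have "\<nexists>f. perfect_matching ?W ?A f"
    using H_factor_of_perfect_matching[OF assms(1) H] no by blast
  then obtain T and \<tau> :: "'a \<times> bool \<Rightarrow> ('a \<times> bool) set" where T: "T \<subseteq> ?W"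
    and \<tau>: "\<And>x y. x \<in> ?W - T \<Longrightarrow> y \<in> ?W - T \<Longrightarrow> (x, y) \<in> ?A \<Longrightarrow> \<tau> x = \<tau> y"
    and lt: "card T < card {Q \<in> \<tau> ` (?W - T). odd (card {x \<in> ?W - T. \<tau> x = Q})}" (is "_ < card ?O")
    using tutte_barrier[OF fW eW A] by blast
  have fT: "finite T" using fW T finite_subset by blast
  have "card (?W - T) = (\<Sum>Q\<in>\<tau> ` (?W - T). card {x \<in> ?W - T. \<tau> x = Q})"
    using card_eq_sum_fibres[of "?W - T" \<tau>] fW by simp
  then have "even (card (?W - T)) \<longleftrightarrow> even (card ?O)"
    using even_sum_iff[of "\<tau> ` (?W - T)"] fW by simp
  moreover have "card ?W = card T + card (?W - T)"
    using card_Diff_subset[OF fT T] card_mono[OF fW T] by simp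
  ultimately have "even (card T) \<longleftrightarrow> even (card ?O)" using eW by simp
  \<comment> \<open>Parity raises the excess from 1 to 2. From here on only the number of classes
    counts, not their oddness.\<close>
  then have "card ?O \<noteq> card T + 1" by auto
  then have "card T + 2 \<le> card ?O" using lt by linarith
  also have "card ?O \<le> card (\<tau> ` (?W - T))" using fW by (intro card_mono) auto
  finally have two: "card T + 2 \<le> card (\<tau> ` (?W - T))" .
  define S where "S = {v \<in> ?V. \<forall>b. (v, b) \<in> ?W \<longrightarrow> (v, b) \<in> T}"
  \<comment> \<open>For \<open>v\<close> outside \<open>S\<close> this picks a copy outside
    \<open>T\<close>.\<close>
  define r where "r v = (if (v, False) \<notin> T then (v, False) else (v, True))" for v
  have r: "r v \<in> ?W - T" "fst (r v) = v" if "v \<in> ?V - S" for v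
    using that by (auto simp: r_def S_def blow_up_verts_def) (metis (full_types))+
  have fst: "fst x \<in> ?V - S" if "x \<in> ?W - T" for x
    using that by (cases x) (auto simp: S_def blow_up_verts_def)
  have \<tau>r: "\<tau> (r (fst x)) = \<tau> x" if "x \<in> ?W - T" for x
  proof (cases "r (fst x) = x")
    case False
    then have "snd (r (fst x)) \<noteq> snd x" using r(2)[OF fst[OF that]] by (auto simp: prod_eq_iff)
    then have "(r (fst x), x) \<in> ?A"
      using r[OF fst[OF that]] that by (auto simp: blow_up_arcs_def)
    then show ?thesis using \<tau> r(1)[OF fst[OF that]] that by blast
  qed simp
  have "\<tau> (r v) = \<tau> (r w)" if "v \<in> ?V - S" "w \<in> ?V - S" "(v, w) \<in> parcs G" for v w
  proof (rule \<tau>)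
    show "r v \<in> ?W - T" "r w \<in> ?W - T" using r that by auto
    then show "(r v, r w) \<in> ?A" using r(2) that by (auto simp: blow_up_arcs_def)
  qed
  moreover have "card S + 2 \<le> card ((\<lambda>v. \<tau> (r v)) ` (?V - S))"
  proof -
    have "card S \<le> card T"
    proof (rule card_inj_on_le[OF _ _ fT])
      show "inj_on (\<lambda>v. (v, False)) S" by (simp add: inj_on_def)
      show "(\<lambda>v. (v, False)) ` S \<subseteq> T"
      proof (rule image_subsetI)
        fix v assume "v \<in> S"
        then have "v \<in> ?V" "(v, False) \<in> ?W \<longrightarrow> (v, False) \<in> T" unfolding S_def by blast+
        then show "(v, False) \<in> T" by (simp add: blow_up_verts_def)
      qed
    qed
    moreover have "\<tau> ` (?W - T) \<subseteq> (\<lambda>v. \<tau> (r v)) ` (?V - S)"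
    proof
      fix Q assume "Q \<in> \<tau> ` (?W - T)"
      then obtain x where "x \<in> ?W - T" "Q = \<tau> x" by blast
      then show "Q \<in> (\<lambda>v. \<tau> (r v)) ` (?V - S)"
        by (metis \<tau>r fst image_eqI)
    qed
    then have "card (\<tau> ` (?W - T)) \<le> card ((\<lambda>v. \<tau> (r v)) ` (?V - S))"
      using pair_finite_verts by (intro card_mono) auto
    ultimately show ?thesis using two by simp
  qed
  ultimately show ?thesis
    by (intro exI[of _ S] exI[of _ "\<lambda>v. \<tau> (r v)"]) (auto simp: S_def)
qed

subsection \<open>Eigenvalues of graphs\<close>

text \<open>Eigenpairs as functions on the vertices, independent of the arbitrary ordering behind
  \<open>adjacency_matrix\<close>.\<close>

definition graph_eigenvalue :: "'a pair_pre_digraph \<Rightarrow> ('a \<Rightarrow> real) \<Rightarrow> real \<Rightarrow> bool" where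
  "graph_eigenvalue G z \<mu> \<longleftrightarrow> (\<exists>v\<in>pverts G. z v \<noteq> 0) \<and>
    (\<forall>v\<in>pverts G. (\<Sum>w | w \<in> pverts G \<and> (v, w) \<in> parcs G. z w) = \<mu> * z v)"

lemma sum_nth_distinct:
  assumes "distinct vs"
  shows "(\<Sum>j<length vs. h (vs ! j)) = sum h (set vs)"
proof -
  have "bij_betw ((!) vs) {..<length vs} (set vs)"
    using bij_betw_nth[OF assms] by blast
  then show ?thesis by (rule sum.reindex_bij_betw)
qed

lemma adjacency_matrix_carrier:
  "adjacency_matrix G \<in> carrier_mat (length (vertex_list G)) (length (vertex_list G))"
  by (simp add: adjacency_matrix_def Let_def)

lemma adjacency_matrix_mult_vec:
  fixes z :: "'a \<Rightarrow> real"
  assumes fin: "finite (pverts G)" and i: "i < length (vertex_list G)"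
    and x: "x \<in> carrier_vec (length (vertex_list G))"
    and z: "\<And>j. j < length (vertex_list G) \<Longrightarrow> x $ j = z (vertex_list G ! j)"
  shows "(adjacency_matrix G *\<^sub>v x) $ i =
    (\<Sum>w | w \<in> pverts G \<and> (vertex_list G ! i, w) \<in> parcs G. z w)"
proof -
  let ?vs = "vertex_list G"
  have "(adjacency_matrix G *\<^sub>v x) $ i =
      (\<Sum>j<length ?vs. if (?vs ! i, ?vs ! j) \<in> parcs G then z (?vs ! j) else 0)"
    using i x z
    by (auto simp: adjacency_matrix_def Let_def mult_mat_vec_def scalar_prod_def atLeast0LessThan
        intro!: sum.cong)
  also have "\<dots> = (\<Sum>w\<in>pverts G. if (?vs ! i, w) \<in> parcs G then z w else 0)"
    using sum_nth_distinct[OF vertex_list(1)[OF fin], of "\<lambda>w. if (?vs ! i, w) \<in> parcs G then z w else 0"]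
    by (simp add: vertex_list(2)[OF fin])
  also have "\<dots> = (\<Sum>w | w \<in> pverts G \<and> (?vs ! i, w) \<in> parcs G. z w)"
    using fin by (simp add: sum.If_cases Int_def)
  finally show ?thesis .
qed

lemma spectrum_adjacency_matrix_iff:
  assumes fin: "finite (pverts G)"
  shows "\<mu> \<in> spectrum (adjacency_matrix G) \<longleftrightarrow> (\<exists>z. graph_eigenvalue G z \<mu>)"
proof
  let ?vs = "vertex_list G" and ?A = "adjacency_matrix G"
  note vs = vertex_list[OF fin]
  note A = adjacency_matrix_carrier[of G]
  assume "\<mu> \<in> spectrum ?A"
  then obtain x where x: "x \<in> carrier_vec (length ?vs)" "x \<noteq> 0\<^sub>v (length ?vs)" "?A *\<^sub>v x = \<mu> \<cdot>\<^sub>v x"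
    using A by (auto simp: spectrum_def eigenvalue_def eigenvector_def)
  define z where "z v = x $ (inv_into {..<length ?vs} ((!) ?vs) v)" for v
  have z: "x $ j = z (?vs ! j)" if "j < length ?vs" for j
    using inj_on_nth[OF vs(1), of "{..<length ?vs}"] that by (simp add: z_def inv_into_f_f)
  have "\<exists>j<length ?vs. x $ j \<noteq> 0"
    using x(1,2) by (metis carrier_vecD eq_vecI index_zero_vec)
  then have "\<exists>v\<in>pverts G. z v \<noteq> 0"
    using z vs(2) nth_mem by metis
  moreover have "(\<Sum>w | w \<in> pverts G \<and> (v, w) \<in> parcs G. z w) = \<mu> * z v" if v: "v \<in> pverts G" for v
  proof -
    obtain i where i: "i < length ?vs" "v = ?vs ! i"
      using v vs(2) by (metis in_set_conv_nth)
    have "(?A *\<^sub>v x) $ i = \<mu> * z v"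
      using i x z by simp
    then show ?thesis
      using adjacency_matrix_mult_vec[OF fin i(1) x(1) z] i(2) by simp
  qed
  ultimately show "\<exists>z. graph_eigenvalue G z \<mu>"
    unfolding graph_eigenvalue_def by blast
next
  let ?vs = "vertex_list G" and ?A = "adjacency_matrix G"
  note vs = vertex_list[OF fin]
  note A = adjacency_matrix_carrier[of G]
  assume "\<exists>z. graph_eigenvalue G z \<mu>"
  then obtain z where z: "\<exists>v\<in>pverts G. z v \<noteq> 0"
    "\<And>v. v \<in> pverts G \<Longrightarrow> (\<Sum>w | w \<in> pverts G \<and> (v, w) \<in> parcs G. z w) = \<mu> * z v"
    unfolding graph_eigenvalue_def by blast
  define x where "x = vec (length ?vs) (\<lambda>j. z (?vs ! j))"
  have x: "x \<in> carrier_vec (length ?vs)" "\<And>j. j < length ?vs \<Longrightarrow> x $ j = z (?vs ! j)"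
    by (auto simp: x_def)
  have "x \<noteq> 0\<^sub>v (length ?vs)"
  proof
    assume "x = 0\<^sub>v (length ?vs)"
    then have "z (?vs ! j) = 0" if "j < length ?vs" for j
      using x(2)[OF that] that by simp
    then show False using z(1) vs(2) by (metis in_set_conv_nth)
  qed
  moreover have "?A *\<^sub>v x = \<mu> \<cdot>\<^sub>v x"
  proof (rule eq_vecI)
    fix i assume "i < dim_vec (\<mu> \<cdot>\<^sub>v x)"
    then have i: "i < length ?vs" using x(1) by simp
    show "(?A *\<^sub>v x) $ i = (\<mu> \<cdot>\<^sub>v x) $ i"
      using adjacency_matrix_mult_vec[OF fin i x] z(2)[of "?vs ! i"] i x vs(2) nth_mem[OF i] by simp
  qed (use A x in auto)
  ultimately show "\<mu> \<in> spectrum ?A"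
    using x(1) A by (auto simp: spectrum_def eigenvalue_def eigenvector_def)
qed

text \<open>\<open>rho\<close> is a \<open>Max\<close>, so the real spectrum has to be nonempty.
  Over the complex numbers an eigenvalue exists. The Hermitian form \<open>q\<close> of an
  eigenvector is real and equals the eigenvalue times the nonzero real \<open>s\<close>, so the
  eigenvalue is real and is a root of the real characteristic polynomial.\<close>

lemma real_symmetric_spectrum_nonempty:
  fixes A :: "real mat"
  assumes A: "A \<in> carrier_mat n n" and n: "n > 0"
    and sym: "\<And>i j. i < n \<Longrightarrow> j < n \<Longrightarrow> A $$ (i, j) = A $$ (j, i)"
  shows "spectrum A \<noteq> {}"
proof -
  interpret of_real_hom: comm_ring_hom complex_of_real by unfold_locales auto
  let ?B = "map_mat complex_of_real A"
  have B: "?B \<in> carrier_mat n n" using A by simp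
  obtain \<mu> where "eigenvalue ?B \<mu>"
    using spectrum_non_empty[OF B n] by (auto simp: spectrum_def)
  then obtain x where x: "x \<in> carrier_vec n" "x \<noteq> 0\<^sub>v n" "?B *\<^sub>v x = \<mu> \<cdot>\<^sub>v x"
    using B by (auto simp: eigenvalue_def eigenvector_def)
  define q where "q = (\<Sum>i<n. \<Sum>j<n. cnj (x $ i) * (of_real (A $$ (i, j)) * x $ j))"
  define s where "s = (\<Sum>i<n. (cmod (x $ i))\<^sup>2)"
  have "cnj q = (\<Sum>i<n. \<Sum>j<n. cnj (x $ j) * (of_real (A $$ (i, j)) * x $ i))"
    by (simp add: q_def mult_ac)
  also have "\<dots> = (\<Sum>j<n. \<Sum>i<n. cnj (x $ j) * (of_real (A $$ (i, j)) * x $ i))"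
    by (rule sum.swap)
  also have "\<dots> = q"
    unfolding q_def using sym by (intro sum.cong refl) auto
  finally have q: "cnj q = q" .
  have row: "(\<Sum>j<n. of_real (A $$ (i, j)) * x $ j) = \<mu> * x $ i" if i: "i < n" for i
  proof -
    have "(?B *\<^sub>v x) $ i = (\<Sum>j<n. of_real (A $$ (i, j)) * x $ j)"
      using A x(1) i by (auto simp: mult_mat_vec_def scalar_prod_def atLeast0LessThan intro!: sum.cong)
    then show ?thesis using x i by simp
  qed
  have "q = (\<Sum>i<n. cnj (x $ i) * (\<mu> * x $ i))"
    unfolding q_def using row by (simp add: sum_distrib_left[symmetric])
  also have "\<dots> = \<mu> * of_real s"
    unfolding s_def of_real_sum sum_distrib_left
    by (intro sum.cong refl) (simp add: complex_norm_square mult_ac del: of_real_power)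
  finally have qs: "q = \<mu> * of_real s" .
  have "s \<noteq> 0"
  proof
    assume "s = 0"
    then have "x $ i = 0" if "i < n" for i
      using that by (simp add: s_def sum_nonneg_eq_0_iff)
    then have "x = 0\<^sub>v n" using x(1) by (intro eq_vecI) auto
    then show False using x(2) by simp
  qed
  then have "cnj \<mu> = \<mu>" using q qs by simp
  then obtain r where r: "\<mu> = of_real r" using Reals_cnj_iff Reals_cases by metis
  have "poly (char_poly ?B) (of_real r) = 0"
    using \<open>eigenvalue ?B \<mu>\<close> r eigenvalue_root_char_poly[OF B] by blast
  then have "poly (char_poly A) r = 0"
    unfolding of_real_hom.char_poly_hom[OF A] by simp
  then show ?thesis using spectrum_root_char_poly[OF A] by blast
qed

lemma rho_is_Max:
  assumes "pair_graph G" and "pverts G \<noteq> {}"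
  shows "\<exists>z. graph_eigenvalue G z (rho G)"
    and "graph_eigenvalue G z \<mu> \<Longrightarrow> \<mu> \<le> rho G"
proof -
  interpret pair_graph G by fact
  let ?A = "adjacency_matrix G" and ?vs = "vertex_list G"
  note A = adjacency_matrix_carrier[of G]
  have "length ?vs > 0" using vertex_list(2)[OF pair_finite_verts] assms(2) by auto
  moreover have "?A $$ (i, j) = ?A $$ (j, i)" if "i < length ?vs" "j < length ?vs" for i j
    using that arcs_symmetric by (auto simp: adjacency_matrix_def Let_def)
  ultimately have ne: "spectrum ?A \<noteq> {}"
    using real_symmetric_spectrum_nonempty[OF A] by blast
  have fin: "finite (spectrum ?A)" using card_finite_spectrum[OF A] by blast
  show "\<exists>z. graph_eigenvalue G z (rho G)"
    using Max_in[OF fin ne] spectrum_adjacency_matrix_iff[OF pair_finite_verts] by (simp add: rho_def)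
  show "graph_eigenvalue G z \<mu> \<Longrightarrow> \<mu> \<le> rho G"
    using Max_ge[OF fin] spectrum_adjacency_matrix_iff[OF pair_finite_verts] by (auto simp: rho_def)
qed

text \<open>
  The set \<open>U\<close> consists of the vertices where \<open>\<bar>z\<bar> / y\<close> is maximal; there the eigenvalue equation for
  \<open>z\<close> and the inequality for \<open>y\<close> can be compared.
\<close>

lemma eigenvalue_ge_supersolution:
  fixes y :: "'a \<Rightarrow> real"
  assumes fin: "finite (pverts G)"
    and y: "\<And>v. v \<in> pverts G \<Longrightarrow> y v > 0"
    and le: "\<And>v. v \<in> pverts G \<Longrightarrow> (\<Sum>w | w \<in> pverts G \<and> (v, w) \<in> parcs G. y w) \<le> \<theta> * y v"
    and z: "graph_eigenvalue G z \<mu>" and ge: "\<mu> \<ge> \<theta>"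
  shows "\<mu> = \<theta> \<and> (\<exists>U. U \<noteq> {} \<and> U \<subseteq> pverts G \<and>
    (\<forall>v\<in>U. \<forall>w\<in>pverts G. (v, w) \<in> parcs G \<longrightarrow> w \<in> U) \<and>
    (\<forall>v\<in>U. (\<Sum>w | w \<in> pverts G \<and> (v, w) \<in> parcs G. y w) = \<theta> * y v))"
proof -
  let ?V = "pverts G"
  let ?N = "\<lambda>v. {w. w \<in> ?V \<and> (v, w) \<in> parcs G}"
  obtain u where u: "u \<in> ?V" "z u \<noteq> 0" using z by (auto simp: graph_eigenvalue_def)
  define t where "t = Max ((\<lambda>v. \<bar>z v\<bar> / y v) ` ?V)"
  have fi: "finite ((\<lambda>v. \<bar>z v\<bar> / y v) ` ?V)" using fin by simp
  have t: "\<bar>z v\<bar> \<le> t * y v" if "v \<in> ?V" for v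
  proof -
    have "\<bar>z v\<bar> / y v \<le> t" unfolding t_def using that by (intro Max_ge[OF fi] imageI)
    then show ?thesis using y[OF that] by (simp add: pos_divide_le_eq)
  qed
  have "t \<ge> \<bar>z u\<bar> / y u" unfolding t_def using u by (intro Max_ge[OF fi] imageI)
  then have t0: "t > 0" using u y[of u] by (smt (verit) divide_pos_pos zero_less_abs_iff)
  define U where "U = {v \<in> ?V. \<bar>z v\<bar> = t * y v}"
  have "t \<in> (\<lambda>v. \<bar>z v\<bar> / y v) ` ?V" using Max_in[OF fi] u by (auto simp: t_def)
  then obtain m where "m \<in> ?V" "t = \<bar>z m\<bar> / y m" by blast
  then have "m \<in> U" using y[of m] by (simp add: U_def)
  have chain: "\<mu> = \<theta> \<and> (\<Sum>w\<in>?N v. y w) = \<theta> * y v \<and> (\<Sum>w\<in>?N v. \<bar>z w\<bar>) = (\<Sum>w\<in>?N v. t * y w)"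
    if v: "v \<in> U" for v
  proof -
    have v': "v \<in> ?V" "\<bar>z v\<bar> = t * y v" "y v > 0" using v y by (auto simp: U_def)
    have "(\<Sum>w\<in>?N v. z w) = \<mu> * z v" using z v' by (simp add: graph_eigenvalue_def)
    then have "\<mu> * \<bar>z v\<bar> \<le> \<bar>\<Sum>w\<in>?N v. z w\<bar>"
      by (simp add: abs_mult mult_right_mono)
    also have "\<dots> \<le> (\<Sum>w\<in>?N v. \<bar>z w\<bar>)" by (rule sum_abs)
    finally have 1: "\<mu> * (t * y v) \<le> (\<Sum>w\<in>?N v. \<bar>z w\<bar>)" using v' by simp
    have 2: "(\<Sum>w\<in>?N v. \<bar>z w\<bar>) \<le> (\<Sum>w\<in>?N v. t * y w)" using t by (intro sum_mono) auto
    have 3: "(\<Sum>w\<in>?N v. t * y w) = t * (\<Sum>w\<in>?N v. y w)" by (simp add: sum_distrib_left)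
    have 4: "t * (\<Sum>w\<in>?N v. y w) \<le> t * (\<theta> * y v)" using le[OF v'(1)] t0 by simp
    have 5: "t * (\<theta> * y v) \<le> \<mu> * (t * y v)" using ge t0 v' by (simp add: mult.left_commute)
    \<comment> \<open>The five estimates start and end at \<open>\<mu> * (t * y v)\<close>, so all
      of them are equalities.\<close>
    have "t * (\<Sum>w\<in>?N v. y w) = t * (\<theta> * y v)" "t * (\<theta> * y v) = \<mu> * (t * y v)"
      "(\<Sum>w\<in>?N v. \<bar>z w\<bar>) = (\<Sum>w\<in>?N v. t * y w)"
      using 1 2 3 4 5 by linarith+
    then show ?thesis using t0 v' by auto
  qed
  have closed: "w \<in> U" if "v \<in> U" "w \<in> ?V" "(v, w) \<in> parcs G" for v w
  proof -
    \<comment> \<open>The sums agree and the terms are ordered, so the terms agree: every neighbour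
      attains the maximal ratio too.\<close>
    have "(\<Sum>w\<in>?N v. t * y w - \<bar>z w\<bar>) = 0" using chain[OF that(1)] by (simp add: sum_subtractf)
    moreover have "finite (?N v)" using fin by simp
    moreover have "\<And>w. w \<in> ?N v \<Longrightarrow> 0 \<le> t * y w - \<bar>z w\<bar>" using t by simp
    ultimately have "\<forall>w\<in>?N v. t * y w - \<bar>z w\<bar> = 0"
      by (meson sum_nonneg_eq_0_iff)
    then show ?thesis using that by (simp add: U_def)
  qed
  show ?thesis
    using chain \<open>m \<in> U\<close> closed by (intro conjI exI[of _ U]) (auto simp: U_def)
qed

lemma connected_closed_subset:
  assumes "pair_graph G" "connected (with_proj G)" "U \<noteq> {}" "U \<subseteq> pverts G"
    and closed: "\<And>v w. v \<in> U \<Longrightarrow> (v, w) \<in> parcs G \<Longrightarrow> w \<in> U"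
  shows "U = pverts G"
proof -
  interpret pair_graph G by fact
  obtain u where u: "u \<in> U" using assms(3) by blast
  have "v \<in> U" if v: "v \<in> pverts G" for v
  proof -
    have "u \<rightarrow>\<^sup>*\<^bsub>mk_symmetric (with_proj G)\<^esub> v"
      using assms(2,4) u v by (auto simp: connected_def strongly_connected_def)
    then have "u \<rightarrow>\<^sup>*\<^bsub>with_proj G\<^esub> v" using reachable_mk_symmetric_eq[OF pair_sym_arcs] by simp
    then show ?thesis
      by (induction rule: reachable_induct) (use u closed in auto)
  qed
  then show ?thesis using assms(4) by blast
qed

subsection \<open>Joins with disjoint unions of complete graphs\<close>

lemma card_singleton_classes_le:
  assumes "pair_graph G" "r_binding 1 G" and S: "S \<subseteq> pverts G" "S \<noteq> pverts G"
    and \<kappa>: "\<forall>v\<in>pverts G - S. \<forall>w\<in>pverts G - S. (v, w) \<in> parcs G \<longrightarrow> \<kappa> v = \<kappa> w"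
  shows "card {Q \<in> \<kappa> ` (pverts G - S). card {v \<in> pverts G - S. \<kappa> v = Q} = 1} \<le> card S"
proof -
  interpret pair_graph G by fact
  let ?V = "pverts G"
  define X where "X = {v \<in> ?V - S. card {w \<in> ?V - S. \<kappa> w = \<kappa> v} = 1}"
  have fX: "finite X" using pair_finite_verts by (simp add: X_def)
  have fS: "finite S" using S(1) pair_finite_verts by (rule finite_subset)
  have N: "neighbors G X \<subseteq> S"
  proof
    fix w assume "w \<in> neighbors G X"
    then obtain v where v: "v \<in> X" "(v, w) \<in> parcs G" by (auto simp: neighbors_def)
    show "w \<in> S"
    proof (rule ccontr)
      assume "w \<notin> S"
      then have w: "w \<in> ?V - S" using v in_arcsD2 by blast
      have v': "v \<in> ?V - S" using v by (simp add: X_def)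
      obtain x where "{u \<in> ?V - S. \<kappa> u = \<kappa> v} = {x}"
        using v(1) by (auto simp: X_def card_1_singleton_iff)
      moreover have "\<kappa> w = \<kappa> v" using \<kappa> v v' w by metis
      then have "{v, w} \<subseteq> {u \<in> ?V - S. \<kappa> u = \<kappa> v}" using v' w by blast
      ultimately have "v = w" by auto
      then show False using v(2) no_loops' by blast
    qed
  qed
  have "card X \<le> card S"
  proof (cases "X = {}")
    case False
    let ?R = "{real (card (neighbors G S)) / real (card S) |S.
      S \<noteq> {} \<and> S \<subseteq> ?V \<and> neighbors G S \<noteq> ?V}"
    have "?R \<subseteq> (\<lambda>S. real (card (neighbors G S)) / real (card S)) ` Pow ?V" by blast
    then have "finite ?R" using pair_finite_verts by (meson finite_Pow_iff finite_imageI finite_subset)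
    moreover have "real (card (neighbors G X)) / real (card X) \<in> ?R"
      using False N S by (intro CollectI exI[of _ X]) (auto simp: X_def)
    ultimately have "binding_number G \<le> real (card (neighbors G X)) / real (card X)"
      unfolding binding_number_def by (rule Min_le)
    then have "1 \<le> real (card (neighbors G X)) / real (card X)"
      using assms(2) by (simp add: r_binding_def)
    moreover have "card X > 0" using False fX by (simp add: card_gt_0_iff)
    ultimately have "card X \<le> card (neighbors G X)" by (simp add: field_simps)
    also have "\<dots> \<le> card S" using N fS by (rule card_mono[rotated])
    finally show ?thesis .
  qed simp
  moreover have "{Q \<in> \<kappa> ` (?V - S). card {v \<in> ?V - S. \<kappa> v = Q} = 1} \<subseteq> \<kappa> ` X"
    by (auto simp: X_def)
  then have "card {Q \<in> \<kappa> ` (?V - S). card {v \<in> ?V - S. \<kappa> v = Q} = 1} \<le> card (\<kappa> ` X)"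
    using fX by (intro card_mono) auto
  moreover have "card (\<kappa> ` X) \<le> card X" using fX by (rule card_image_le)
  ultimately show ?thesis by linarith
qed

text \<open>
  The neighbourhood of \<open>v\<close> in the join of the complete graph on \<open>S\<close> with the disjoint union of the
  complete graphs on the classes of \<open>\<kappa>\<close>.
\<close>

definition join_nbrs :: "'a set \<Rightarrow> 'a set \<Rightarrow> ('a \<Rightarrow> 'b) \<Rightarrow> 'a \<Rightarrow> 'a set" where
  "join_nbrs V S \<kappa> v =
    (if v \<in> S then V - {v} else S \<union> {w \<in> V - S. \<kappa> w = \<kappa> v} - {v})"

definition class_size :: "'a set \<Rightarrow> 'a set \<Rightarrow> ('a \<Rightarrow> 'b) \<Rightarrow> 'b \<Rightarrow> nat" where
  "class_size V S \<kappa> Q = card {v \<in> V - S. \<kappa> v = Q}"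

text \<open>
  With weight 1 on \<open>S\<close>, this weight on the classes is forced by the equation \<open>A y = \<theta> y\<close> off \<open>S\<close>.
\<close>

definition join_weight :: "'a set \<Rightarrow> 'a set \<Rightarrow> ('a \<Rightarrow> 'b) \<Rightarrow> real \<Rightarrow> 'a \<Rightarrow> real" where
  "join_weight V S \<kappa> \<theta> v = (if v \<in> S then 1 else real (card S) / (\<theta> + 1 - real (class_size V S \<kappa> (\<kappa> v))))"

text \<open>Off \<open>S\<close> the equation holds exactly, and on \<open>S\<close> the sum does
  not depend on the vertex. Hence one scalar inequality decides whether the weight is a
  supersolution.\<close>

lemma sum_join_weight:
  fixes \<kappa> :: "'a \<Rightarrow> 'b" and \<theta> :: real
  assumes V: "finite V" "S \<subseteq> V"
    and pos: "\<And>v. v \<in> V - S \<Longrightarrow> real (class_size V S \<kappa> (\<kappa> v)) < \<theta> + 1"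
  shows "v \<in> V - S \<Longrightarrow> sum (join_weight V S \<kappa> \<theta>) (join_nbrs V S \<kappa> v) = \<theta> * join_weight V S \<kappa> \<theta> v"
    and "v \<in> S \<Longrightarrow> sum (join_weight V S \<kappa> \<theta>) (join_nbrs V S \<kappa> v) =
      real (card S) - 1 + (\<Sum>Q\<in>\<kappa> ` (V - S). real (class_size V S \<kappa> Q) * (real (card S) / (\<theta> + 1 - real (class_size V S \<kappa> Q))))"
proof -
  let ?y = "join_weight V S \<kappa> \<theta>" and ?c = "class_size V S \<kappa>"
  let ?F = "\<lambda>Q. {w \<in> V - S. \<kappa> w = Q}"
  have fS: "finite S" using V finite_subset by blast
  have yS: "sum ?y S = real (card S)" by (simp add: join_weight_def)
  have yF: "sum ?y (?F Q) = real (?c Q) * (real (card S) / (\<theta> + 1 - real (?c Q)))" for Q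
  proof -
    have "sum ?y (?F Q) = (\<Sum>w\<in>?F Q. real (card S) / (\<theta> + 1 - real (?c Q)))"
      by (intro sum.cong refl) (auto simp: join_weight_def)
    then show ?thesis by (simp add: class_size_def)
  qed
  show "sum ?y (join_nbrs V S \<kappa> v) = \<theta> * ?y v" if v: "v \<in> V - S"
  proof -
    have "sum ?y (join_nbrs V S \<kappa> v) = sum ?y (S \<union> ?F (\<kappa> v)) - ?y v"
      using v V fS by (simp add: join_nbrs_def sum_diff1)
    also have "sum ?y (S \<union> ?F (\<kappa> v)) = sum ?y S + sum ?y (?F (\<kappa> v))"
      using fS V by (intro sum.union_disjoint) auto
    finally have sum: "sum ?y (join_nbrs V S \<kappa> v) = real (card S) + real (?c (\<kappa> v)) * ?y v - ?y v"
      unfolding yS yF using v by (simp add: join_weight_def)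
    have "?y v * (\<theta> + 1 - real (?c (\<kappa> v))) = real (card S)"
      using pos[OF v] v by (simp add: join_weight_def)
    then show ?thesis using sum by (simp add: algebra_simps)
  qed
  show "sum ?y (join_nbrs V S \<kappa> v) = real (card S) - 1 + (\<Sum>Q\<in>\<kappa> ` (V - S). real (?c Q) * (real (card S) / (\<theta> + 1 - real (?c Q))))"
    if v: "v \<in> S"
  proof -
    have "sum ?y (V - S) = (\<Sum>Q\<in>\<kappa> ` (V - S). sum ?y (?F Q))"
      using V by (intro sum.image_gen) auto
    moreover have "sum ?y V = sum ?y S + sum ?y (V - S)"
      using V by (metis add.commute sum.subset_diff)
    moreover have "sum ?y (join_nbrs V S \<kappa> v) = sum ?y V - ?y v"
      using v V by (auto simp: join_nbrs_def sum_diff1)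
    moreover have "?y v = 1" using v by (simp add: join_weight_def)
    ultimately show ?thesis unfolding yS yF by linarith
  qed
qed

section \<open>Estimates for the class sizes\<close>

lemma two_card_le_sum_plus_ones:
  fixes c :: "'b \<Rightarrow> nat"
  assumes "finite A" "\<And>i. i \<in> A \<Longrightarrow> c i \<ge> 1"
  shows "2 * card A \<le> sum c A + card {i \<in> A. c i = 1}"
proof -
  have "2 * card A = (\<Sum>i\<in>A. 2)" by simp
  also have "\<dots> \<le> (\<Sum>i\<in>A. c i + (if c i = 1 then 1 else 0))"
  proof (rule sum_mono)
    fix i assume "i \<in> A"
    then have "c i \<ge> 1" by (rule assms(2))
    then show "2 \<le> c i + (if c i = 1 then 1 else 0)" by simp
  qed
  also have "\<dots> = sum c A + card {i \<in> A. c i = 1}"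
    using assms(1) by (simp add: sum.distrib sum.If_cases Int_def)
  finally show ?thesis .
qed

text \<open>
  Each summand is a convex function of \<open>c j\<close>, so it is bounded by its chord over \<open>[1, m - \<delta>]\<close>, and the
  chords add up to a linear function of the number of classes and of the sum of the \<open>c j\<close>.
\<close>

lemma sum_class_weights_le:
  fixes c :: "'b \<Rightarrow> nat" and m \<delta> s :: real
  assumes J: "finite J" "real (card J) \<ge> s + 2" "(\<Sum>j\<in>J. real (c j)) = m + 3 - s"
    and c: "\<And>j. j \<in> J \<Longrightarrow> 1 \<le> c j" "\<And>j. j \<in> J \<Longrightarrow> real (c j) + \<delta> \<le> m"
    and "\<delta> > 0" "\<delta> \<le> m" "s > 0" "m > 1"
    and key: "s * (s + 2) * \<delta> + s * m * (m + 1 - 2 * s) \<le> (m - s) * (m - 1) * \<delta>"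
  shows "(\<Sum>j\<in>J. real (c j) * (s / (m - real (c j)))) \<le> m - s"
proof -
  \<comment> \<open>\<open>m / (m - x)\<close> is the slope of the chord of
    \<open>x * (m - 1) / (m - x)\<close> from 1 to \<open>x\<close>; it grows with \<open>x\<close>
    and reaches \<open>k\<close> at \<open>x = m - \<delta>\<close>.\<close>
  define k where "k = m / \<delta>"
  have k: "k \<ge> 1" using assms by (simp add: k_def)
  have chord: "real (c j) * (s / (m - real (c j))) \<le> s / (m - 1) * (1 + (real (c j) - 1) * k)" if j: "j \<in> J" for j
  proof -
    define x where "x = real (c j)"
    have x: "1 \<le> x" "x + \<delta> \<le> m" using c[OF j] by (simp_all add: x_def)
    have "m / (m - x) \<le> k"
      unfolding k_def using x assms by (intro divide_left_mono) auto
    then have "(x - 1) * (m / (m - x)) \<le> (x - 1) * k"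
      using x by (intro mult_left_mono) auto
    moreover have "x * (m - 1) / (m - x) = 1 + (x - 1) * (m / (m - x))"
      using x assms by (simp add: field_simps)
    ultimately have "x * (m - 1) / (m - x) \<le> 1 + (x - 1) * k" by simp
    then have "s / (m - 1) * (x * (m - 1) / (m - x)) \<le> s / (m - 1) * (1 + (x - 1) * k)"
      using assms by (intro mult_left_mono) auto
    moreover have "s / (m - 1) * (x * (m - 1) / (m - x)) = x * (s / (m - x))"
      using assms by simp
    ultimately have "x * (s / (m - x)) \<le> s / (m - 1) * (1 + (x - 1) * k)" by linarith
    then show ?thesis by (simp only: x_def)
  qed
  have "(\<Sum>j\<in>J. real (c j) * (s / (m - real (c j)))) \<le> (\<Sum>j\<in>J. s / (m - 1) * (1 + (real (c j) - 1) * k))"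
    using chord by (rule sum_mono)
  also have "\<dots> = s / (m - 1) * (\<Sum>j\<in>J. (1 - k) + real (c j) * k)"
    unfolding sum_distrib_left by (intro sum.cong refl) (simp add: algebra_simps)
  also have "(\<Sum>j\<in>J. (1 - k) + real (c j) * k) = real (card J) * (1 - k) + (m + 3 - s) * k"
    using J(3) by (simp add: sum.distrib flip: sum_distrib_right)
  \<comment> \<open>As \<open>1 - k \<le> 0\<close>, additional classes only lower the bound, so
    their number may be replaced by \<open>s + 2\<close>.\<close>
  also have "s / (m - 1) * \<dots> \<le> s / (m - 1) * ((s + 2) * (1 - k) + (m + 3 - s) * k)"
    using J(2) k assms by (intro mult_left_mono add_right_mono mult_right_mono_neg) auto
  also have "\<dots> = (s * (s + 2) * \<delta> + s * m * (m + 1 - 2 * s)) / ((m - 1) * \<delta>)"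
    using assms by (simp add: k_def field_simps)
  also have "\<dots> \<le> m - s"
    using key assms by (simp add: divide_le_eq mult_ac)
  finally show ?thesis .
qed

text \<open>Counting two vertices per class, with at most \<open>s\<close> singletons, gives
  \<open>c j \<le> n - 2 * s - 2\<close>. For \<open>m = n - 3\<close> this is the gap
  \<open>\<delta> = 2 * s - 1\<close>, which suffices when \<open>s \<ge> 2\<close>. For
  \<open>s = 1\<close> the gap 1 is too small, but the gap 2 suffices; it is missed only by a class
  of size \<open>n - 4\<close>, and this fixes the other sizes.\<close>

lemma class_sizes_cases:
  fixes c :: "'b \<Rightarrow> nat" and n s :: nat
  assumes J: "finite J" "card J \<ge> s + 2" "sum c J = n - s"
    and c: "\<And>j. j \<in> J \<Longrightarrow> 1 \<le> c j" and ones: "card {j \<in> J. c j = 1} \<le> s"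
    and s: "1 \<le> s" "s \<le> n" and n: "n \<ge> 11"
  obtains (small) "\<And>j. j \<in> J \<Longrightarrow> c j < n - 3"
      "(\<Sum>j\<in>J. real (c j) * (real s / (real (n - 3) - real (c j)))) \<le> real (n - 3) - real s"
    | (exceptional) p q r where "s = 1" "J = {p, q, r}" "p \<noteq> q" "p \<noteq> r" "q \<noteq> r"
      "c p = n - 4" "c q = 2" "c r = 1"
proof -
  have rest: "2 * (card J - 1) \<le> sum c (J - {j}) + s" "c j + sum c (J - {j}) = n - s" if "j \<in> J" for j
  proof -
    have "2 * card (J - {j}) \<le> sum c (J - {j}) + card {i \<in> J - {j}. c i = 1}"
      using J c by (intro two_card_le_sum_plus_ones) auto
    moreover have "card {i \<in> J - {j}. c i = 1} \<le> card {i \<in> J. c i = 1}"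
      using J by (intro card_mono) auto
    ultimately show "2 * (card J - 1) \<le> sum c (J - {j}) + s" using that ones J by simp
    show "c j + sum c (J - {j}) = n - s" using sum.remove[of J j c] J that by simp
  qed
  have le: "c j + 2 * s + 2 \<le> n" if "j \<in> J" for j using rest[OF that] J(2) s by linarith
  have le_real: "real (c j) + 2 * real s + 2 \<le> real n" if "j \<in> J" for j
    using of_nat_mono[OF le[OF that], where 'a = real] by simp
  have "2 * card J \<le> sum c J + card {j \<in> J. c j = 1}"
    using J c by (intro two_card_le_sum_plus_ones) auto
  then have ns: "n \<ge> 2 * s + 4" using J ones s by linarith
  have sum: "(\<Sum>j\<in>J. real (c j)) = real (n - 3) + 3 - real s"
    using J(3) s n by (simp add: of_nat_diff flip: of_nat_sum)
  define m where "m = real (n - 3)"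
  have m: "m = real n - 3" "m \<ge> 8" "m \<ge> 2 * real s + 1" using n ns by (auto simp: m_def of_nat_diff)
  show ?thesis
  proof (cases "s = 1")
    case False
    then have s2: "real s \<ge> 2" using s by simp
    have "real s * (real s + 2) * (2 * real s - 1) + real s * m * (m + 1 - 2 * real s) \<le> (m - real s) * (m - 1) * (2 * real s - 1)"
    proof -
      define t where "t = real s"
      have t: "t \<ge> 2" "m \<ge> 2 * t + 1" using s2 m by (simp_all add: t_def)
      \<comment> \<open>The required inequality with its terms collected by powers of
        \<open>m\<close>. For \<open>t \<ge> 3\<close> the bound \<open>m \<ge> 2 * t + 1\<close>
        suffices; for \<open>t = 2\<close> it does not, and \<open>m \<ge> 8\<close> is
        used.\<close>
      have "(t\<^sup>2 + t) * (2 * t - 1) + m * (2 * t - 1) \<le> m\<^sup>2 * (t - 1)"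
      proof (cases "s = 2")
        case True
        have "8 * m \<le> m * m" using m by (intro mult_right_mono) auto
        then show ?thesis using True m by (simp add: t_def power2_eq_square)
      next
        case False
        then have t3: "t \<ge> 3" using s2 by (simp add: t_def)
        have "(2 * t + 1) * (t - 1) - (2 * t - 1) \<le> m * (t - 1) - (2 * t - 1)"
          using t by (intro diff_right_mono mult_right_mono) auto
        moreover have "(2 * t + 1) * (t - 1) - (2 * t - 1) = t * (2 * t - 3)" by (simp add: algebra_simps)
        ultimately have "(2 * t + 1) * (t * (2 * t - 3)) \<le> m * (m * (t - 1) - (2 * t - 1))"
          using t t3 m by (intro mult_mono) auto
        moreover have "(2 * t + 1) * (t * (2 * t - 3)) - (t\<^sup>2 + t) * (2 * t - 1) = t * (2 * t * (t - 3) + (t - 2))"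
          by (simp add: algebra_simps power2_eq_square)
        moreover have "t * (2 * t * (t - 3) + (t - 2)) \<ge> 0" using t3 by (intro mult_nonneg_nonneg add_nonneg_nonneg) auto
        ultimately show ?thesis by (simp add: algebra_simps power2_eq_square)
      qed
      then have "t * (t + 2) * (2 * t - 1) + t * m * (m + 1 - 2 * t) \<le> (m - t) * (m - 1) * (2 * t - 1)"
        by (simp add: algebra_simps power2_eq_square)
      then show ?thesis by (simp add: t_def)
    qed
    then have "(\<Sum>j\<in>J. real (c j) * (real s / (m - real (c j)))) \<le> m - real s"
      using J sum c le m s2 by (intro sum_class_weights_le[where \<delta> = "2 * real s - 1"]) (auto simp: m(1) add_ac dest!: le_real)
    then show ?thesis using small le s n by (force simp: m_def)
  next
    case True
    show ?thesis
    proof (cases "\<forall>j\<in>J. c j + 5 \<le> n")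
      case True
      have "8 * m \<le> m * m" using m by (intro mult_right_mono) auto
      \<comment> \<open>For \<open>s = 1\<close> and \<open>\<delta> = 2\<close> the key inequality
        reduces to this one.\<close>
      then have "4 + m * 3 \<le> m * m" using m(2) by linarith
      then have key: "1 * (1 + 2) * 2 + 1 * m * (m + 1 - 2 * 1) \<le> (m - 1) * (m - 1) * 2"
        by (simp add: algebra_simps)
      have "real (c j) + 2 \<le> m" if "j \<in> J" for j
        using True that m(1) of_nat_mono[of "c j + 5" n, where 'a = real] by auto
      then have "(\<Sum>j\<in>J. real (c j) * (real s / (m - real (c j)))) \<le> m - real s"
        using J sum c m(2) \<open>s = 1\<close> key
        by (intro sum_class_weights_le[where \<delta> = 2]) (simp_all add: m_def[symmetric])
      then show ?thesis using small True n by (force simp: m_def)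
    next
      case False
      then obtain p where p: "p \<in> J" "c p + 5 > n" by auto
      then have cp: "c p = n - 4" using le[OF p(1)] \<open>s = 1\<close> by simp
      then have r3: "sum c (J - {p}) = 3" using rest(2)[OF p(1)] \<open>s = 1\<close> n by simp
      \<comment> \<open>The classes other than \<open>p\<close> have 3 elements in total and at most
        one of them is a singleton, so there are at most two.\<close>
      then have "card J = 3" using rest(1)[OF p(1)] \<open>s = 1\<close> J(2) by simp
      then have "card (J - {p}) = 2" using p J by simp
      then obtain q r where qr: "J - {p} = {q, r}" "q \<noteq> r" by (auto simp: card_2_iff)
      then have "c q + c r = 3" "1 \<le> c q" "1 \<le> c r" using r3 c[of q] c[of r] by auto
      then consider "c q = 2" "c r = 1" | "c q = 1" "c r = 2" by linarith
      then show ?thesis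
        using exceptional[of p q r] exceptional[of p r q] p qr cp \<open>s = 1\<close> by cases auto
    qed
  qed
qed

subsection \<open>The extremal graph\<close>

lemma digraph_isoI:
  assumes "pair_graph G" "pair_graph G'" and \<phi>: "bij_betw \<phi> (pverts G) (pverts G')"
    and arcs: "\<And>v w. v \<in> pverts G \<Longrightarrow> w \<in> pverts G \<Longrightarrow> (v, w) \<in> parcs G \<longleftrightarrow> (\<phi> v, \<phi> w) \<in> parcs G'"
  shows "digraph_iso (with_proj G) (with_proj G')"
proof -
  interpret G: pair_graph G by fact
  interpret G': pair_graph G' by fact
  let ?h = "\<lparr>iso_verts = \<phi>, iso_arcs = map_prod \<phi> \<phi>, iso_head = snd, iso_tail = fst\<rparr>"
  have inj: "inj_on \<phi> (pverts G)" and im: "\<phi> ` pverts G = pverts G'"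
    using \<phi> by (auto simp: bij_betw_def)
  have "inj_on (map_prod \<phi> \<phi>) (pverts G \<times> pverts G)" using inj by (simp add: map_prod_inj_on)
  moreover have "parcs G \<subseteq> pverts G \<times> pverts G" using G.in_arcsD1 G.in_arcsD2 by auto
  ultimately have "inj_on (map_prod \<phi> \<phi>) (parcs G)" by (rule inj_on_subset)
  moreover have "wf_digraph (with_proj G)" by (simp add: wf_digraph_wp_iff) unfold_locales
  ultimately have "pre_digraph.digraph_isomorphism (with_proj G) ?h"
    using inj by (simp add: pre_digraph.digraph_isomorphism_def)
  moreover have "map_prod \<phi> \<phi> ` parcs G = parcs G'"
  proof (intro equalityI subsetI)
    fix e assume "e \<in> map_prod \<phi> \<phi> ` parcs G"
    then obtain v w where vw: "(v, w) \<in> parcs G" "e = (\<phi> v, \<phi> w)" by auto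
    then show "e \<in> parcs G'" using arcs[OF G.in_arcsD1 G.in_arcsD2, OF vw(1) vw(1)] by simp
  next
    fix e assume e: "e \<in> parcs G'"
    then have "fst e \<in> \<phi> ` pverts G" "snd e \<in> \<phi> ` pverts G"
      using im G'.arc_fst_in_verts G'.arc_snd_in_verts by auto
    then obtain v w where vw: "v \<in> pverts G" "w \<in> pverts G" "e = (\<phi> v, \<phi> w)"
      by (auto simp: image_iff prod_eq_iff)
    then have "(v, w) \<in> parcs G" using arcs[OF vw(1,2)] e by simp
    then show "e \<in> map_prod \<phi> \<phi> ` parcs G" using vw(3) by (intro image_eqI[of _ _ "(v, w)"]) simp_all
  qed
  then have "with_proj G' = app_iso ?h (with_proj G)"
    using im by (simp add: app_iso_def with_proj_def)
  ultimately show ?thesis unfolding digraph_iso_def by blast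
qed

text \<open>The labels 1, 2, 3 number the three cliques and play the role of
  \<open>\<kappa>\<close>; the central vertex gets the placeholder 0.\<close>

definition extremal_class :: "nat + (nat + nat) + nat \<Rightarrow> nat" where
  "extremal_class x = (case x of Inl _ \<Rightarrow> 0 | Inr (Inl (Inl _)) \<Rightarrow> 1 | Inr (Inl (Inr _)) \<Rightarrow> 2 | Inr (Inr _) \<Rightarrow> 3)"

lemma pair_graph_complete_graph: "pair_graph (complete_graph m)"
  by (auto simp: pair_graph_iff complete_graph_def sym_def irrefl_def)

lemma pair_graph_extremal_graph: "pair_graph (extremal_graph n)"
  unfolding extremal_graph_def
  by (intro pair_graph_graph_join pair_graph_disjoint_union pair_graph_complete_graph)

lemma pverts_extremal_graph:
  "pverts (extremal_graph n) = {Inl 0} \<union> (\<lambda>i. Inr (Inl (Inl i))) ` {..<n - 4} \<union>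
    (\<lambda>i. Inr (Inl (Inr i))) ` {..<2} \<union> {Inr (Inr 0)}"
  by (auto simp: extremal_graph_def graph_join_def disjoint_union_def complete_graph_def)

lemma parcs_disjoint_union_iff:
  "(x, y) \<in> parcs (disjoint_union G1 G2) \<longleftrightarrow> (case (x, y) of
    (Inl a, Inl b) \<Rightarrow> (a, b) \<in> parcs G1 | (Inr a, Inr b) \<Rightarrow> (a, b) \<in> parcs G2 | _ \<Rightarrow> False)"
  by (cases x; cases y) (force simp: disjoint_union_def)+

lemma parcs_graph_join_iff:
  "(x, y) \<in> parcs (graph_join G1 G2) \<longleftrightarrow> (case (x, y) of
    (Inl a, Inl b) \<Rightarrow> (a, b) \<in> parcs G1 | (Inr a, Inr b) \<Rightarrow> (a, b) \<in> parcs G2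
    | (Inl a, Inr b) \<Rightarrow> a \<in> pverts G1 \<and> b \<in> pverts G2
    | (Inr b, Inl a) \<Rightarrow> a \<in> pverts G1 \<and> b \<in> pverts G2)"
  by (cases x; cases y) (auto simp: graph_join_def parcs_disjoint_union_iff)

lemma parcs_extremal_graph:
  "(x, y) \<in> parcs (extremal_graph n) \<longleftrightarrow> x \<in> pverts (extremal_graph n) \<and> y \<in> pverts (extremal_graph n) \<and>
    x \<noteq> y \<and> (x = Inl 0 \<or> y = Inl 0 \<or> extremal_class x = extremal_class y)"
  unfolding pverts_extremal_graph
  by (auto simp: extremal_graph_def parcs_graph_join_iff parcs_disjoint_union_iff disjoint_union_def
      complete_graph_def extremal_class_def split: sum.splits)

lemma class_size_extremal_graph:
  assumes "n \<ge> 5"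
  shows "extremal_class ` (pverts (extremal_graph n) - {Inl 0}) = {1, 2, 3}"
    and "class_size (pverts (extremal_graph n)) {Inl 0} extremal_class 1 = n - 4"
    and "class_size (pverts (extremal_graph n)) {Inl 0} extremal_class 2 = 2"
    and "class_size (pverts (extremal_graph n)) {Inl 0} extremal_class 3 = 1"
proof -
  let ?W = "pverts (extremal_graph n) - {Inl 0}"
  have 1: "{x \<in> ?W. extremal_class x = 1} = (\<lambda>i. Inr (Inl (Inl i))) ` {..<n - 4}"
    and 2: "{x \<in> ?W. extremal_class x = 2} = (\<lambda>i. Inr (Inl (Inr i))) ` {..<2}"
    and 3: "{x \<in> ?W. extremal_class x = 3} = {Inr (Inr 0)}"
    by (auto simp: pverts_extremal_graph extremal_class_def)
  show "class_size (pverts (extremal_graph n)) {Inl 0} extremal_class 1 = n - 4"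
    "class_size (pverts (extremal_graph n)) {Inl 0} extremal_class 2 = 2"
    "class_size (pverts (extremal_graph n)) {Inl 0} extremal_class 3 = 1"
    unfolding class_size_def 1 2 3 by (simp_all add: card_image inj_on_def)
  have "?W = (\<lambda>i. Inr (Inl (Inl i))) ` {..<n - 4} \<union> (\<lambda>i. Inr (Inl (Inr i))) ` {..<2} \<union> {Inr (Inr 0)}"
    by (auto simp: pverts_extremal_graph)
  moreover have "{..<n - 4} \<noteq> {}" "{..<2::nat} \<noteq> {}" using assms by (auto simp: lessThan_empty_iff)
  ultimately show "extremal_class ` ?W = {1, 2, 3}"
    by (simp add: image_Un image_image extremal_class_def image_constant_conv) blast
qed

text \<open>This presents the extremal graph as a full join over its central vertex, so that
  \<open>sum_join_weight\<close> applies to it.\<close>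

lemma join_nbrs_extremal_graph:
  "v \<in> pverts (extremal_graph n) \<Longrightarrow>
    {w. w \<in> pverts (extremal_graph n) \<and> (v, w) \<in> parcs (extremal_graph n)} =
    join_nbrs (pverts (extremal_graph n)) {Inl 0} extremal_class v"
  by (auto simp: parcs_extremal_graph join_nbrs_def) (auto simp: pverts_extremal_graph)

text \<open>
  The equation says that \<open>join_weight\<close> solves \<open>A y = \<theta> y\<close> also at the central vertex of the extremal
  graph, whose classes have sizes \<open>n - 4\<close>, \<open>2\<close> and \<open>1\<close>.
\<close>

lemma extremal_root:
  assumes n: "n \<ge> 11"
  obtains \<theta> :: real where "\<theta> > real n - 4"
    "(real n - 4) / (\<theta> + 5 - real n) + 2 / (\<theta> - 1) + 1 / \<theta> = \<theta>"
proof -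
  define h where "h x = (real n - 4) / (x + 5 - real n) + 2 / (x - 1) + 1 / x - x" for x
  \<comment> \<open>At \<open>n - 4\<close> the first denominator is 1, so the first term cancels
    \<open>x\<close> and two positive terms remain.\<close>
  have "h (real n - 4) > 0" using n by (auto simp: h_def add_pos_pos)
  have "(real n - 4) / 5 \<le> real n / 5" "2 / (real n - 1) \<le> 1 / 5" "1 / real n \<le> 1 / 5"
    using n by (auto simp: field_simps)
  moreover have "h (real n) = (real n - 4) / 5 + 2 / (real n - 1) + 1 / real n - real n"
    by (simp add: h_def)
  moreover have "real n \<ge> 11" using n by simp
  ultimately have "h (real n) \<le> 0" by linarith
  have cont: "\<forall>x. real n - 4 \<le> x \<and> x \<le> real n \<longrightarrow> isCont h x"
    unfolding h_def using n by (auto intro!: continuous_intros)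
  obtain \<theta> where \<theta>: "real n - 4 \<le> \<theta>" "h \<theta> = 0"
    using IVT2[OF \<open>h (real n) \<le> 0\<close> less_imp_le[OF \<open>h (real n - 4) > 0\<close>] _ cont] by auto
  moreover have "\<theta> \<noteq> real n - 4" using \<theta> \<open>h (real n - 4) > 0\<close> by auto
  ultimately show ?thesis using that[of \<theta>] by (auto simp: h_def)
qed

text \<open>The weight is an eigenvector for \<open>\<theta>\<close>. Equality would also hold, but
  the lower bound is all that the comparison with \<open>rho G\<close> requires.\<close>

lemma rho_extremal_graph_ge:
  assumes n: "n \<ge> 11" and \<theta>: "\<theta> > real n - 4"
    "(real n - 4) / (\<theta> + 5 - real n) + 2 / (\<theta> - 1) + 1 / \<theta> = \<theta>"
  shows "\<theta> \<le> rho (extremal_graph n)"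
proof (rule rho_is_Max(2)[OF pair_graph_extremal_graph])
  let ?V = "pverts (extremal_graph n)" and ?S = "{Inl 0} :: (nat + (nat + nat) + nat) set"
  let ?c = "class_size ?V ?S extremal_class"
  let ?y = "join_weight ?V ?S extremal_class \<theta>"
  have sz: "extremal_class ` (?V - ?S) = {1, 2, 3}" "?c 1 = n - 4" "?c 2 = 2" "?c 3 = 1"
    using class_size_extremal_graph[of n] n by auto
  show ne: "?V \<noteq> {}" by (auto simp: pverts_extremal_graph)
  have fin: "finite ?V" "?S \<subseteq> ?V" by (auto simp: pverts_extremal_graph)
  have pos: "real (?c (extremal_class v)) < \<theta> + 1" if "v \<in> ?V - ?S" for v
  proof -
    have "extremal_class v \<in> {1, 2, 3}" using sz(1) that by blast
    then show ?thesis using sz(2-4) n \<theta>(1) by auto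
  qed
  have "(\<Sum>Q\<in>{1,2,3::nat}. real (?c Q) * (real (card ?S) / (\<theta> + 1 - real (?c Q)))) = \<theta>"
    using sz(2-4) n \<theta>(2) by (simp add: of_nat_diff algebra_simps)
  then have "sum ?y (join_nbrs ?V ?S extremal_class v) = \<theta> * ?y v" if "v \<in> ?V" for v
    using sum_join_weight[OF fin, of extremal_class \<theta> v] pos that sz(1)
    by (cases "v \<in> ?S") (simp_all add: join_weight_def[of _ _ _ _ "Inl 0"])
  moreover have "?y (Inl 0) \<noteq> 0" by (simp add: join_weight_def)
  ultimately show "graph_eigenvalue (extremal_graph n) ?y \<theta>"
    using fin(2) unfolding graph_eigenvalue_def by (auto simp: join_nbrs_extremal_graph)
qed

text \<open>Adjacency depends only on the class labels and on the central vertex, so any numbering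
  of the three classes gives an isomorphism.\<close>

lemma digraph_iso_extremal_graph:
  assumes G: "pair_graph G" and u: "u \<in> pverts G"
    and cl: "\<kappa> ` (pverts G - {u}) = {p, q, r}" "p \<noteq> q" "p \<noteq> r" "q \<noteq> r"
    and sz: "class_size (pverts G) {u} \<kappa> p = n - 4" "class_size (pverts G) {u} \<kappa> q = 2"
      "class_size (pverts G) {u} \<kappa> r = 1"
    and nbrs: "\<And>v. v \<in> pverts G \<Longrightarrow> {w. w \<in> pverts G \<and> (v, w) \<in> parcs G} = join_nbrs (pverts G) {u} \<kappa> v"
  shows "digraph_iso (with_proj G) (with_proj (extremal_graph n))"
proof -
  interpret pair_graph G by fact
  let ?V = "pverts G"
  let ?F = "\<lambda>Q. {v \<in> ?V - {u}. \<kappa> v = Q}"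
  have "\<forall>Q. \<exists>h. bij_betw h (?F Q) {0..<card (?F Q)}"
    using pair_finite_verts by (intro allI ex_bij_betw_finite_nat) simp
  from choice[OF this] obtain h where h: "\<And>Q. bij_betw (h Q) (?F Q) {0..<card (?F Q)}" by blast
  have hp: "bij_betw (h p) (?F p) {..<n - 4}" and hq: "bij_betw (h q) (?F q) {..<2}"
    and hr: "bij_betw (h r) (?F r) {..<1}"
    using h[of p] h[of q] h[of r] sz by (simp_all add: class_size_def atLeast0LessThan)
  define \<phi> :: "'a \<Rightarrow> nat + (nat + nat) + nat" where
    "\<phi> v = (if v = u then Inl 0 else if \<kappa> v = p then Inr (Inl (Inl (h p v)))
      else if \<kappa> v = q then Inr (Inl (Inr (h q v))) else Inr (Inr (h r v)))" for v
  have V: "?V = {u} \<union> ?F p \<union> ?F q \<union> ?F r" using cl(1) u by blast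
  have "\<phi> ` {u} = {Inl 0}" by (simp add: \<phi>_def)
  moreover have "\<phi> ` ?F p = (\<lambda>i. Inr (Inl (Inl i))) ` h p ` ?F p"
    unfolding image_image by (intro image_cong) (auto simp: \<phi>_def)
  moreover have "\<phi> ` ?F q = (\<lambda>i. Inr (Inl (Inr i))) ` h q ` ?F q"
    unfolding image_image using cl by (intro image_cong) (auto simp: \<phi>_def)
  moreover have "\<phi> ` ?F r = (\<lambda>i. Inr (Inr i)) ` h r ` ?F r"
    unfolding image_image using cl by (intro image_cong) (auto simp: \<phi>_def)
  moreover have "h p ` ?F p = {..<n - 4}" "h q ` ?F q = {..<2}" "h r ` ?F r = {..<1}"
    using hp hq hr by (simp_all only: bij_betw_def)
  ultimately have "\<phi> ` ({u} \<union> ?F p \<union> ?F q \<union> ?F r) = pverts (extremal_graph n)"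
    unfolding image_Un pverts_extremal_graph by (simp only:) (simp add: lessThan_Suc)
  then have im: "\<phi> ` ?V = pverts (extremal_graph n)" by (simp only: V[symmetric])
  have cls: "\<kappa> v \<in> {p, q, r}" if "v \<in> ?V" "v \<noteq> u" for v using cl(1) that by blast
  have inj: "inj_on \<phi> ?V"
  proof (rule inj_onI)
    fix v w assume vw: "v \<in> ?V" "w \<in> ?V" "\<phi> v = \<phi> w"
    show "v = w"
    proof (cases "v = u \<or> w = u")
      case True
      then show ?thesis using vw(3) by (auto simp: \<phi>_def split: if_splits)
    next
      case False
      then have "\<kappa> v = \<kappa> w" "h (\<kappa> v) v = h (\<kappa> w) w"
        using vw cls[of v] cls[of w] by (auto simp: \<phi>_def split: if_splits)
      then show ?thesis
        using bij_betw_imp_inj_on[OF h[of "\<kappa> v"]] vw False by (auto simp: inj_on_def)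
    qed
  qed
  have class_iff: "extremal_class (\<phi> v) = extremal_class (\<phi> w) \<longleftrightarrow> \<kappa> v = \<kappa> w"
    if "v \<in> ?V" "w \<in> ?V" "v \<noteq> u" "w \<noteq> u" for v w
    using cls[of v] cls[of w] that cl(2-4) by (auto simp: \<phi>_def extremal_class_def)
  have \<phi>u: "\<phi> v = Inl 0 \<longleftrightarrow> v = u" for v by (simp add: \<phi>_def)
  have arc: "(v, w) \<in> parcs G \<longleftrightarrow> v \<noteq> w \<and> (v = u \<or> w = u \<or> \<kappa> v = \<kappa> w)"
    if "v \<in> ?V" "w \<in> ?V" for v w
  proof -
    have "(v, w) \<in> parcs G \<longleftrightarrow> w \<in> join_nbrs ?V {u} \<kappa> v" using nbrs[OF that(1)] that by blast
    then show ?thesis using that by (auto simp: join_nbrs_def)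
  qed
  show ?thesis
  proof (rule digraph_isoI[OF G pair_graph_extremal_graph])
    show "bij_betw \<phi> ?V (pverts (extremal_graph n))" using inj im by (simp add: bij_betw_def)
    fix v w assume vw: "v \<in> ?V" "w \<in> ?V"
    then have "\<phi> v \<in> pverts (extremal_graph n)" "\<phi> w \<in> pverts (extremal_graph n)" using im by blast+
    then show "(v, w) \<in> parcs G \<longleftrightarrow> (\<phi> v, \<phi> w) \<in> parcs (extremal_graph n)"
      using arc[OF vw] class_iff[OF vw] vw inj_on_eq_iff[OF inj vw] \<phi>u by (auto simp: parcs_extremal_graph)
  qed
qed

section \<open>From a missing factor to the extremal graph\<close>

theorem theorem1p2:
  fixes G :: "'a pair_pre_digraph" and n :: nat
  assumes "pair_graph G"
    and "connected (with_proj G)"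
    and "card (pverts G) = n" and "n \<ge> 11"
    and "r_binding 1 G"
    and "rho G \<ge> rho (extremal_graph n)"
    and "\<not> digraph_iso (with_proj G) (with_proj (extremal_graph n))"
  shows "\<forall>H :: 'a \<Rightarrow> nat set.
    (\<forall>v\<in>pverts G. H v \<in> {{1}, {0, 2}}) \<and> even (card {v \<in> pverts G. H v = {1}})
      \<longrightarrow> (\<exists>F. H_factor H G F)"
proof (intro allI impI, rule ccontr)
  fix H :: "'a \<Rightarrow> nat set"
  assume H: "(\<forall>v\<in>pverts G. H v \<in> {{1}, {0, 2}}) \<and> even (card {v \<in> pverts G. H v = {1}})"
    and no: "\<nexists>F. H_factor H G F"
  interpret pair_graph G by fact
  let ?V = "pverts G"
  obtain S and \<kappa> :: "'a \<Rightarrow> ('a \<times> bool) set" where S: "S \<subseteq> ?V"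
    and \<kappa>: "\<forall>v\<in>?V - S. \<forall>w\<in>?V - S. (v, w) \<in> parcs G \<longrightarrow> \<kappa> v = \<kappa> w"
    and two: "card S + 2 \<le> card (\<kappa> ` (?V - S))"
    using barrier_of_no_H_factor[OF assms(1), of H] H no by blast
  let ?J = "\<kappa> ` (?V - S)" and ?c = "class_size ?V S \<kappa>"
  have fS: "finite S" using S pair_finite_verts by (rule finite_subset)
  have fJ: "finite ?J" using pair_finite_verts by simp
  have ne: "S \<noteq> ?V" using two by auto
  \<comment> \<open>For empty \<open>S\<close> every class is closed under adjacency, so
    connectedness leaves a single class instead of two.\<close>
  have "S \<noteq> {}"
  proof
    assume "S = {}"
    then have "?J \<noteq> {}" and J2: "\<not> card ?J \<le> 1" using two by auto
    then obtain u where u: "u \<in> ?V" by blast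
    have "{v \<in> ?V. \<kappa> v = \<kappa> u} = ?V"
      using \<open>S = {}\<close> \<kappa> u in_arcsD2 by (intro connected_closed_subset[OF assms(1,2)]) force+
    then have "?J \<subseteq> {\<kappa> u}" by blast
    then show False using J2 card_mono[of "{\<kappa> u}" ?J] by simp
  qed
  then have s: "card S > 0" using fS by (simp add: card_gt_0_iff)
  have sn: "card S \<le> n" using S assms(3) card_mono[OF pair_finite_verts] by blast
  have c1: "1 \<le> ?c Q" if "Q \<in> ?J" for Q
  proof -
    have "{v \<in> ?V - S. \<kappa> v = Q} \<noteq> {}" using that by blast
    then show ?thesis using pair_finite_verts by (simp add: class_size_def Suc_le_eq card_gt_0_iff)
  qed
  have sumc: "sum ?c ?J = n - card S"
    using card_eq_sum_fibres[of "?V - S" \<kappa>] pair_finite_verts card_Diff_subset[OF fS S] assms(3)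
    by (simp add: class_size_def)
  have ones: "card {Q \<in> ?J. ?c Q = 1} \<le> card S"
    using card_singleton_classes_le[OF assms(1,5) S ne \<kappa>] by (simp add: class_size_def)
  obtain \<theta> where \<theta>: "\<theta> > real n - 4"
    "(real n - 4) / (\<theta> + 5 - real n) + 2 / (\<theta> - 1) + 1 / \<theta> = \<theta>"
    using extremal_root[OF assms(4)] by blast
  have rho: "rho G \<ge> \<theta>" using rho_extremal_graph_ge[OF assms(4) \<theta>] assms(6) by simp
  have Vne: "?V \<noteq> {}" using ne S by blast
  obtain z where z: "graph_eigenvalue G z (rho G)" using rho_is_Max(1)[OF assms(1) Vne] by blast
  have nbrs: "{w. w \<in> ?V \<and> (v, w) \<in> parcs G} \<subseteq> join_nbrs ?V S \<kappa> v" if "v \<in> ?V" for v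
    using \<kappa> that no_loops'[of v v] by (auto simp: join_nbrs_def)
  have fin_nbrs: "finite (join_nbrs ?V S \<kappa> v)" for v
    using fS pair_finite_verts by (simp add: join_nbrs_def)
  \<comment> \<open>Stated for a general \<open>t\<close>, because it serves with
    \<open>t = n - 4\<close> for small classes and with \<open>t = \<theta>\<close> in the
    exceptional case. The hypothesis \<open>le\<close> is the inequality at the vertices of
    \<open>S\<close>.\<close>
  have super: "(\<Sum>w | w \<in> ?V \<and> (v, w) \<in> parcs G. join_weight ?V S \<kappa> t w) \<le> t * join_weight ?V S \<kappa> t v"
    "join_weight ?V S \<kappa> t v > 0" "v \<in> ?V \<Longrightarrow> w \<in> join_nbrs ?V S \<kappa> v \<Longrightarrow> join_weight ?V S \<kappa> t w > 0"
    "sum (join_weight ?V S \<kappa> t) (join_nbrs ?V S \<kappa> v) \<le> t * join_weight ?V S \<kappa> t v"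
    if v: "v \<in> ?V" and pos: "\<And>Q. Q \<in> ?J \<Longrightarrow> real (?c Q) < t + 1"
      and le: "(\<Sum>Q\<in>?J. real (?c Q) * (real (card S) / (t + 1 - real (?c Q)))) \<le> t + 1 - real (card S)"
    for t v w
  proof -
    let ?y = "join_weight ?V S \<kappa> t"
    have y: "?y x > 0" if "x \<in> ?V" for x
      using pos[of "\<kappa> x"] that s by (auto simp: join_weight_def)
    then show "?y v > 0" using v by blast
    have sub: "join_nbrs ?V S \<kappa> v \<subseteq> ?V" using S by (auto simp: join_nbrs_def)
    then show "w \<in> join_nbrs ?V S \<kappa> v \<Longrightarrow> ?y w > 0" using y by blast
    have p: "\<And>x. x \<in> ?V - S \<Longrightarrow> real (?c (\<kappa> x)) < t + 1" using pos by blast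
    show *: "sum ?y (join_nbrs ?V S \<kappa> v) \<le> t * ?y v"
    proof (cases "v \<in> S")
      case True
      then have "?y v = 1" by (simp add: join_weight_def)
      then show ?thesis using sum_join_weight(2)[OF pair_finite_verts S p True] le by simp
    next
      case False
      then show ?thesis using sum_join_weight(1)[OF pair_finite_verts S p] v by simp
    qed
    have "(\<Sum>w | w \<in> ?V \<and> (v, w) \<in> parcs G. ?y w) \<le> sum ?y (join_nbrs ?V S \<kappa> v)"
    proof (rule sum_mono2[OF fin_nbrs nbrs[OF v]])
      fix x assume "x \<in> join_nbrs ?V S \<kappa> v - {w. w \<in> ?V \<and> (v, w) \<in> parcs G}"
      then show "0 \<le> ?y x" using y[of x] sub by auto
    qed
    then show "(\<Sum>w | w \<in> ?V \<and> (v, w) \<in> parcs G. ?y w) \<le> t * ?y v" using * by linarith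
  qed
  have s1: "1 \<le> card S" using s by simp
  show False
  proof (rule class_sizes_cases[OF fJ two sumc c1 ones s1 sn assms(4)])
    assume small: "\<And>Q. Q \<in> ?J \<Longrightarrow> ?c Q < n - 3"
      "(\<Sum>Q\<in>?J. real (?c Q) * (real (card S) / (real (n - 3) - real (?c Q)))) \<le> real (n - 3) - real (card S)"
    have t: "real (n - 3) = real n - 4 + 1" using assms(4) by (simp add: of_nat_diff)
    have pos: "real (?c Q) < real n - 4 + 1" if "Q \<in> ?J" for Q
      using small(1)[OF that] t by (metis of_nat_less_iff)
    \<comment> \<open>An eigenvalue that is at least the constant of a supersolution equals it,
      whereas \<open>rho G \<ge> \<theta> > n - 4\<close>.\<close>
    have "rho G = real n - 4"
      using eigenvalue_ge_supersolution[OF pair_finite_verts super(2,1) z] pos small(2)[unfolded t] rho \<theta>(1)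
      by force
    then show False using rho \<theta>(1) by simp
  next
    fix p q r
    assume exceptional: "card S = 1" "?J = {p, q, r}" "p \<noteq> q" "p \<noteq> r" "q \<noteq> r"
      "?c p = n - 4" "?c q = 2" "?c r = 1"
    then obtain u where u: "S = {u}" by (metis One_nat_def card_1_singletonE)
    have pos: "real (?c Q) < \<theta> + 1" if "Q \<in> ?J" for Q
      using that exceptional \<theta>(1) assms(4) by auto
    \<comment> \<open>For the sizes \<open>n - 4\<close>, 2, 1 both sides are equal, by the equation
      defining \<open>\<theta>\<close>.\<close>
    have "(\<Sum>Q\<in>?J. real (?c Q) * (real (card S) / (\<theta> + 1 - real (?c Q)))) \<le> \<theta> + 1 - real (card S)"
      using exceptional \<theta>(2) assms(4) by (simp add: of_nat_diff algebra_simps)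
    note super = super[OF _ pos this]
    obtain U where U: "U \<noteq> {}" "U \<subseteq> ?V" "\<forall>v\<in>U. \<forall>w\<in>?V. (v, w) \<in> parcs G \<longrightarrow> w \<in> U"
      "\<forall>v\<in>U. (\<Sum>w | w \<in> ?V \<and> (v, w) \<in> parcs G. join_weight ?V S \<kappa> \<theta> w) = \<theta> * join_weight ?V S \<kappa> \<theta> v"
      using eigenvalue_ge_supersolution[OF pair_finite_verts super(2,1) z rho] by blast
    \<comment> \<open>By connectedness the equality in the supersolution inequality spreads to all
      vertices.\<close>
    have "U = ?V" using connected_closed_subset[OF assms(1,2) U(1,2)] U(3) in_arcsD2 by blast
    have "{w. w \<in> ?V \<and> (v, w) \<in> parcs G} = join_nbrs ?V S \<kappa> v" if v: "v \<in> ?V" for v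
    proof (rule ccontr)
      assume "\<not> ?thesis"
      then obtain x where x: "x \<in> join_nbrs ?V S \<kappa> v" "x \<notin> {w. w \<in> ?V \<and> (v, w) \<in> parcs G}"
        using nbrs[OF v] by blast
      \<comment> \<open>A missing neighbour \<open>x\<close> has positive weight, which would make
        the inequality at \<open>v\<close> strict.\<close>
      have "(\<Sum>w | w \<in> ?V \<and> (v, w) \<in> parcs G. join_weight ?V S \<kappa> \<theta> w) <
          sum (join_weight ?V S \<kappa> \<theta>) (join_nbrs ?V S \<kappa> v)"
        using nbrs[OF v] x fin_nbrs super(3)[OF v _ v]
        by (intro sum_strict_mono2[of _ _ x]) (auto intro: less_imp_le)
      then show False using super(4)[OF v] U(4) \<open>U = ?V\<close> v by fastforce
    qed
    then have "digraph_iso (with_proj G) (with_proj (extremal_graph n))"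
      using exceptional u S assms(1,4)
      by (intro digraph_iso_extremal_graph[where u = u and \<kappa> = \<kappa> and p = p and q = q and r = r]) auto
    then show False using assms(7) by blast
  qed
qed

end
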